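(* Let $a_n^0>0$ and $b_n^0\in\mathbb{R}$, $n=1,2,\ldots$, be given sequences, let $A^0$ be the corresponding semi-infinite Jacobi matrix, and let $d\rho^0_{\infty,\alpha}$ be the spectral measure of its self-adjoint realization $A^0_{\infty,\alpha}$ described in the context. Suppose that $$\operatorname{supp}\{d\rho^0_{\infty,\alpha}\}\subset(-\infty,M)\quad\text{for some } M\in\mathbb{R}.$$ For $t\geqslant 0$ put $$\Omega_\alpha(t)=\int_{\mathbb{R}}e^{2\lambda t}\,d\rho^0_{\infty,\alpha}(\lambda),\qquad s_k(t)=\frac{\int_{\mathbb{R}}\lambda^k e^{2\lambda t}\,d\rho^0_{\infty,\alpha}(\lambda)}{\int_{\mathbb{R}}e^{2\lambda t}\,d\rho^0_{\infty,\alpha}(\lambda)},\quad k=0,1,2,\ldots$$ These functions satisfy $s_0(t)=1$ for $t\geqslant0$ and the recurrent relation $$\dot s_k(t)+\left(\ln \Omega_\alpha(t)\right)' s_k(t)=2s_{k+1}(t),\quad k=0,1,\ldots,\ t>0.$$ The solution $a_n(t)$, $b_n(t)$, $n=1,2,\ldots$, of the semi-infinite Toda lattice with the given initial data is determined by the moments $s_k(t)$, $k=0,1,\ldots$, in the following sense: for every $t\geqslant0$ there is a unique semi-infinite Jacobi matrix $H(t)$ with off-diagonal entries $a_n(t)>0$ and diagonal entries $b_n(t)\in\mathbb{R}$ whose moments are $s_k(t)$, $k=0,1,\ldots$, and these functions $a_n(t)$, $b_n(t)$ satisfy $$\dot a_n(t)=a_n(t)\left(b_{n+1}(t)-b_n(t)\right),\qquad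 \dot b_n(t)=2\left(a_n^2(t)-a_{n-1}^2(t)\right),\qquad t\geqslant0,\ n=1,2,\ldots$$ (with $a_0\equiv0$), together with $a_n(0)=a_n^0$, $b_n(0)=b_n^0$, $n=1,2,\ldots$
   Context: A dot or prime denotes $d/dt$ (one-sided at $t=0$). A semi-infinite Jacobi matrix with off-diagonal entries $a_n>0$ and diagonal entries $b_n\in\mathbb{R}$ ($n\ge1$) is the symmetric tridiagonal matrix $H$ with $H_{nn}=b_n$, $H_{n,n+1}=H_{n+1,n}=a_n$ and all other entries zero. Its moments are the numbers $s_k=(H^k)_{11}$, $k\ge0$ (entries of powers of a tridiagonal matrix are finite sums); equivalently $s_k=\int\lambda^k\,d\rho(\lambda)$ for any spectral measure $d\rho$ of $H$ with respect to $e_1=(1,0,0,\ldots)$, i.e. $d\rho(\lambda)=d[E_\lambda e_1,e_1]$, where $E$ is the projection-valued spectral measure of a self-adjoint extension in $l_2$ of the operator given by $H$ on finite sequences and $[\cdot,\cdot]$ is the scalar product in $l_2$. $A^0$ is the Jacobi matrix with off-diagonal entries $a_n^0$ and diagonal entries $b_n^0$, regarded also as a symmetric operator in $l_2$ with domain the finitely supported sequences; $\overline{A^0}$ is its closure and $(A^0)^*$ its adjoint. If its deficiency indices are $(0,0)$ (limit point case), $A^0_{\infty,\alpha}$ means the unique self-adjoint extension $\overline{A^0}$. If its deficiency indices are $(1,1)$ (limit circle case), let $p(\lambda)=(p_n(\lambda))_{n\ge1}$, $q(\lambda)=(q_n(\lambda))_{n\ge1}$ be the solutions of $a^0_n\phi_{n+1}+a^0_{n-1}\phi_{n-1}+b^0_n\phi_n=\lambda\phi_n$,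 $n\ge2$, with $p_1=1$, $p_2=(\lambda-b^0_1)/a^0_1$, $q_1=0$, $q_2=1/a^0_1$, and set $\alpha=-\lim_{n\to\infty}q_n(0)/p_n(0)\in\mathbb{R}\cup\{\infty\}$. Then $A^0_{\infty,\alpha}$ is the self-adjoint restriction of $(A^0)^*$ to $D(\overline{A^0})\dot+\operatorname{span}\{q(0)+\alpha p(0)\}$ if $\alpha\in\mathbb{R}$, and to $D(\overline{A^0})\dot+\operatorname{span}\{p(0)\}$ if $\alpha=\infty$. The measure $d\rho^0_{\infty,\alpha}(\lambda)=d[E_\lambda e_1,e_1]$, with $E$ the projection-valued spectral measure of $A^0_{\infty,\alpha}$, is the spectral measure of $A^0_{\infty,\alpha}$. *)

theory Defs
  imports "HOL-Analysis.Analysis" "HOL-Library.Function_Algebras"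
begin

text \<open>
  All sequences are indexed from 1 as in the mathematics, so a sequence is a function on \<open>nat\<close>
  whose value at 0 is not an entry. For coefficient sequences this value is never used; for vectors
  it is fixed to be 0.
\<close>

section \<open>Jacobi matrices and their moments\<close>

definition jacobi_matrix :: "(nat \<Rightarrow> real) \<Rightarrow> (nat \<Rightarrow> real) \<Rightarrow> nat \<Rightarrow> nat \<Rightarrow> real" where
  "jacobi_matrix a b i j =
     (if j = i then b i else if j = Suc i then a i else if i = Suc j then a j else 0)"

text \<open>The sum may stop at \<open>Suc j\<close> because column \<open>j\<close> of the matrix vanishes below row \<open>Suc j\<close>.\<close>

fun jacobi_power :: "(nat \<Rightarrow> real) \<Rightarrow> (nat \<Rightarrow> real) \<Rightarrow> nat \<Rightarrow> nat \<Rightarrow> nat \<Rightarrow> real" where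
  "jacobi_power a b 0 i j = (if i = j then 1 else 0)"
| "jacobi_power a b (Suc k) i j =
     (\<Sum>l = 1..Suc j. jacobi_power a b k i l * jacobi_matrix a b l j)"

definition jacobi_moment :: "(nat \<Rightarrow> real) \<Rightarrow> (nat \<Rightarrow> real) \<Rightarrow> nat \<Rightarrow> real" where
  "jacobi_moment a b k = jacobi_power a b k 1 1"


section \<open>The complex Hilbert space of square summable sequences\<close>

type_synonym cseq = "nat \<Rightarrow> complex"

definition l2 :: "cseq set" where
  "l2 = {x. x 0 = 0 \<and> summable (\<lambda>n. (cmod (x n))\<^sup>2)}"

definition l2_inner :: "cseq \<Rightarrow> cseq \<Rightarrow> complex" where
  "l2_inner x y = (\<Sum>n. x n * cnj (y n))"

definition l2_norm :: "cseq \<Rightarrow> real" where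
  "l2_norm x = sqrt (\<Sum>n. (cmod (x n))\<^sup>2)"

definition cscale :: "complex \<Rightarrow> cseq \<Rightarrow> cseq" where
  "cscale c x = (\<lambda>n. c * x n)"

interpretation cseq: vector_space cscale
  by unfold_locales (auto simp: cscale_def fun_eq_iff algebra_simps)

definition e1 :: cseq where
  "e1 = (\<lambda>n. if n = 1 then 1 else 0)"


section \<open>Unbounded operators, identified with their graphs\<close>

type_synonym l2_op = "(cseq \<times> cseq) set"

definition op_closure :: "l2_op \<Rightarrow> l2_op" where
  "op_closure T = {(x, y). x \<in> l2 \<and> y \<in> l2 \<and>
     (\<exists>X Y. (\<forall>n::nat. (X n, Y n) \<in> T) \<and>
       (\<lambda>n. l2_norm (X n - x)) \<longlonglongrightarrow> 0 \<and> (\<lambda>n. l2_norm (Y n - y)) \<longlonglongrightarrow> 0)}"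

definition op_adjoint :: "l2_op \<Rightarrow> l2_op" where
  "op_adjoint T = {(y, z). y \<in> l2 \<and> z \<in> l2 \<and> (\<forall>(x, w) \<in> T. l2_inner w y = l2_inner x z)}"

definition has_cdim :: "cseq set \<Rightarrow> nat \<Rightarrow> bool" where
  "has_cdim V d \<longleftrightarrow> (\<exists>B. finite B \<and> card B = d \<and> cseq.independent B \<and> cseq.span B = V)"

definition eigenspace :: "l2_op \<Rightarrow> complex \<Rightarrow> cseq set" where
  "eigenspace T z = {x. (x, cscale z x) \<in> T}"

definition deficiency_indices :: "l2_op \<Rightarrow> nat \<Rightarrow> nat \<Rightarrow> bool" where
  "deficiency_indices T m n \<longleftrightarrow>
     has_cdim (eigenspace (op_adjoint T) \<i>) m \<and> has_cdim (eigenspace (op_adjoint T) (- \<i>)) n"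


section \<open>Projection-valued measures\<close>

definition orthogonal_projection :: "(cseq \<Rightarrow> cseq) \<Rightarrow> bool" where
  "orthogonal_projection P \<longleftrightarrow>
     (\<forall>x\<in>l2. P x \<in> l2 \<and> P (P x) = P x) \<and>
     (\<forall>x\<in>l2. \<forall>y\<in>l2. P (x + y) = P x + P y \<and> l2_inner (P x) y = l2_inner x (P y)) \<and>
     (\<forall>c. \<forall>x\<in>l2. P (cscale c x) = cscale c (P x))"

definition projection_valued_measure :: "(real set \<Rightarrow> cseq \<Rightarrow> cseq) \<Rightarrow> bool" where
  "projection_valued_measure E \<longleftrightarrow>
     (\<forall>B\<in>sets borel. orthogonal_projection (E B)) \<and>
     (\<forall>x\<in>l2. E UNIV x = x) \<and>
     (\<forall>B\<in>sets borel. \<forall>C\<in>sets borel. \<forall>x\<in>l2. E (B \<inter> C) x = E B (E C x)) \<and>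
     (\<forall>F :: nat \<Rightarrow> real set. range F \<subseteq> sets borel \<longrightarrow> disjoint_family F \<longrightarrow>
        (\<forall>x\<in>l2. (\<lambda>N. l2_norm ((\<Sum>i<N. E (F i) x) - E (\<Union>i. F i) x)) \<longlonglongrightarrow> 0))"

text \<open>The scalar measure \<open>d[E x, x]\<close>; its values are real and nonnegative when \<open>E\<close> is a
  projection-valued measure and \<open>x \<in> l2\<close>.\<close>

definition pvm_measure :: "(real set \<Rightarrow> cseq \<Rightarrow> cseq) \<Rightarrow> cseq \<Rightarrow> real measure" where
  "pvm_measure E x = measure_of UNIV (sets borel) (\<lambda>B. ennreal (Re (l2_inner (E B x) x)))"

text \<open>\<open>T\<close> is the operator of integration of \<open>\<lambda>\<close> against \<open>dE\<close>: its domain consists of the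
  \<open>x\<close> for which \<open>\<lambda>\<^sup>2\<close> is integrable with respect to \<open>d[E x, x]\<close>, and its
  quadratic form, which determines it by polarization, is the integral of \<open>\<lambda>\<close>.\<close>

definition spectral_pvm :: "(real set \<Rightarrow> cseq \<Rightarrow> cseq) \<Rightarrow> l2_op \<Rightarrow> bool" where
  "spectral_pvm E T \<longleftrightarrow>
     projection_valued_measure E \<and>
     Domain T = {x \<in> l2. integrable (pvm_measure E x) (\<lambda>l. l\<^sup>2)} \<and>
     (\<forall>(x, y) \<in> T. l2_inner y x = complex_of_real (\<integral>l. l \<partial>pvm_measure E x))"

definition measure_support :: "real measure \<Rightarrow> real set" where
  "measure_support \<mu> = {x. \<forall>U. open U \<longrightarrow> x \<in> U \<longrightarrow> emeasure \<mu> U > 0}"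


section \<open>The self-adjoint realization of a Jacobi matrix\<close>

definition jacobi_apply :: "(nat \<Rightarrow> real) \<Rightarrow> (nat \<Rightarrow> real) \<Rightarrow> cseq \<Rightarrow> cseq" where
  "jacobi_apply a b x =
     (\<lambda>n. if n = 0 then 0 else \<Sum>j = 1..Suc n. of_real (jacobi_matrix a b n j) * x j)"

definition jacobi_op :: "(nat \<Rightarrow> real) \<Rightarrow> (nat \<Rightarrow> real) \<Rightarrow> l2_op" where
  "jacobi_op a b = {(x, jacobi_apply a b x) | x. x 0 = 0 \<and> finite {n. x n \<noteq> 0}}"

fun sol_p :: "(nat \<Rightarrow> real) \<Rightarrow> (nat \<Rightarrow> real) \<Rightarrow> complex \<Rightarrow> nat \<Rightarrow> complex" where
  "sol_p a b z 0 = 0"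
| "sol_p a b z (Suc 0) = 1"
| "sol_p a b z (Suc (Suc 0)) = (z - of_real (b 1)) / of_real (a 1)"
| "sol_p a b z (Suc (Suc (Suc n))) =
     ((z - of_real (b (n + 2))) * sol_p a b z (Suc (Suc n))
        - of_real (a (n + 1)) * sol_p a b z (Suc n)) / of_real (a (n + 2))"

fun sol_q :: "(nat \<Rightarrow> real) \<Rightarrow> (nat \<Rightarrow> real) \<Rightarrow> complex \<Rightarrow> nat \<Rightarrow> complex" where
  "sol_q a b z 0 = 0"
| "sol_q a b z (Suc 0) = 0"
| "sol_q a b z (Suc (Suc 0)) = 1 / of_real (a 1)"
| "sol_q a b z (Suc (Suc (Suc n))) =
     ((z - of_real (b (n + 2))) * sol_q a b z (Suc (Suc n))
        - of_real (a (n + 1)) * sol_q a b z (Suc n)) / of_real (a (n + 2))"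

datatype ext_param = Fin real | Infty

text \<open>\<open>\<alpha> = - lim q\<^sub>n(0) / p\<^sub>n(0)\<close> in the real projective line; the quotient is the point at
  infinity when \<open>p\<^sub>n(0) = 0\<close> (then \<open>q\<^sub>n(0) \<noteq> 0\<close>).\<close>

fun is_alpha_limit :: "(nat \<Rightarrow> real) \<Rightarrow> (nat \<Rightarrow> real) \<Rightarrow> ext_param \<Rightarrow> bool" where
  "is_alpha_limit a b (Fin r) \<longleftrightarrow>
     (\<forall>\<^sub>F n in sequentially. sol_p a b 0 n \<noteq> 0) \<and>
     (\<lambda>n. - (sol_q a b 0 n / sol_p a b 0 n)) \<longlonglongrightarrow> complex_of_real r"
| "is_alpha_limit a b Infty \<longleftrightarrow>
     (\<forall>\<^sub>F n in sequentially. sol_q a b 0 n \<noteq> 0) \<and>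
     (\<lambda>n. sol_p a b 0 n / sol_q a b 0 n) \<longlonglongrightarrow> 0"

fun ext_vector :: "(nat \<Rightarrow> real) \<Rightarrow> (nat \<Rightarrow> real) \<Rightarrow> ext_param \<Rightarrow> cseq" where
  "ext_vector a b (Fin r) = sol_q a b 0 + cscale (of_real r) (sol_p a b 0)"
| "ext_vector a b Infty = sol_p a b 0"

text \<open>The deficiency indices of a Jacobi operator are \<open>(0,0)\<close> or \<open>(1,1)\<close>, so the second branch
  is the limit circle case. In the limit point case \<open>\<alpha>\<close> plays no role.\<close>

definition jacobi_realization ::
    "(nat \<Rightarrow> real) \<Rightarrow> (nat \<Rightarrow> real) \<Rightarrow> ext_param \<Rightarrow> l2_op" where
  "jacobi_realization a b \<alpha> =
     (if deficiency_indices (jacobi_op a b) 0 0 then op_closure (jacobi_op a b)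
      else {(x, y) \<in> op_adjoint (jacobi_op a b).
              \<exists>u \<in> Domain (op_closure (jacobi_op a b)).
              \<exists>v \<in> cseq.span {ext_vector a b \<alpha>}. x = u + v})"

end

theory Submission
  imports Defs "HOL-Computational_Algebra.Polynomial"
begin

text \<open>
  Every realization of the Jacobi matrix \<open>A\<close> acts by the three-term expression and has the
  finitely supported vectors in its domain. For such a vector \<open>x\<close>, its spectral measure \<open>E\<close>
  satisfies \<open>d[E A x, A x] = \<lambda>\<^sup>2 d[E x, x]\<close>, which gives existence of all moments of the spectral
  measure and their equality with the matrix moments; the choice of the self-adjoint extension
  plays no role. Since \<open>d\<rho>\<close> lives on a half-line bounded above, the weighted moments
  \<open>m\<^sub>k(t) = \<integral> \<lambda>\<^sup>k e\<^bsup>2\<lambda>t\<^esup> d\<rho>\<close> exist and satisfy \<open>m\<^sub>k' = 2 m\<^sub>k\<^sub>+\<^sub>1\<close>. For any positive definite moment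
  sequence with this property, the monic orthogonal polynomials \<open>\<pi>\<^sub>n\<close> satisfy
  \<open>\<pi>\<^sub>n' = - 2 a\<^sub>n\<^sup>2 \<pi>\<^sub>n\<^sub>-\<^sub>1\<close> by induction along their three-term recurrence, and the Toda equations
  follow by differentiating the recurrence coefficients \<open>a\<^sub>n\<^sup>2 = L(\<pi>\<^sub>n\<^sup>2) / L(\<pi>\<^sub>n\<^sub>-\<^sub>1\<^sup>2)\<close> and
  \<open>b\<^sub>n\<^sub>+\<^sub>1 = L(\<lambda> \<pi>\<^sub>n\<^sup>2) / L(\<pi>\<^sub>n\<^sup>2)\<close>, where \<open>L\<close> is the moment functional.
\<close>

section \<open>Moment functionals and orthogonal polynomials\<close>

text \<open>The Riesz functional L of a moment sequence. If \<open>m\<close> consists of the moments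
  of a measure, it is integration of polynomials against that measure.\<close>

definition mfun :: "(nat \<Rightarrow> real) \<Rightarrow> real poly \<Rightarrow> real" where
  "mfun m p = (\<Sum>i\<le>degree p. coeff p i * m i)"

lemma mfun_eq_sum:
  assumes "degree p \<le> N"
  shows "mfun m p = (\<Sum>i\<le>N. coeff p i * m i)"
  unfolding mfun_def
  by (rule sum.mono_neutral_left) (use assms in \<open>auto simp: coeff_eq_0\<close>)

lemma mfun_add: "mfun m (p + q) = mfun m p + mfun m q"
proof -
  define N where "N = max (degree p) (degree q)"
  have "degree p \<le> N" "degree q \<le> N" "degree (p + q) \<le> N"
    by (auto simp: N_def degree_add_le)
  then show ?thesis
    by (simp add: mfun_eq_sum sum.distrib[symmetric] algebra_simps)
qed

lemma mfun_smult: "mfun m (smult c p) = c * mfun m p"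
  using mfun_eq_sum[of "smult c p" "degree p" m] degree_smult_le[of c p]
  by (simp add: mfun_def sum_distrib_left algebra_simps)

lemma mfun_minus [simp]: "mfun m (- p) = - mfun m p"
  using mfun_smult[of m "-1" p] by simp

lemma mfun_diff: "mfun m (p - q) = mfun m p - mfun m q"
  using mfun_add[of m p "- q"] by simp

lemma mfun_0 [simp]: "mfun m 0 = 0"
  by (simp add: mfun_def)

lemma mfun_monom [simp]: "mfun m (monom c k) = c * m k"
proof (cases "c = 0")
  case False
  have "mfun m (monom c k) = (\<Sum>i\<le>k. (if i = k then c * m k else 0))"
    unfolding mfun_def using False by (intro sum.cong) (auto simp: degree_monom_eq)
  then show ?thesis by simp
qed simp

lemma mfun_1 [simp]: "mfun m 1 = m 0"
  using mfun_monom[of m 1 0] by (simp flip: one_pCons add: monom_0)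

lemma mfun_divide: "mfun (\<lambda>k. m k / c) p = mfun m p / c"
  by (simp add: mfun_def sum_divide_distrib)

lemmas mfun_simps = mfun_add mfun_diff mfun_smult

lemma mfun_mult_eq_0:
  assumes "\<And>k. k \<le> degree p \<Longrightarrow> mfun m (monom 1 k * q) = 0"
  shows "mfun m (p * q) = 0"
proof -
  have "p * q = (\<Sum>k\<le>degree p. smult (coeff p k) (monom 1 k * q))"
    by (subst poly_as_sum_of_monoms[of p, symmetric])
       (simp add: sum_distrib_right smult_monom flip: mult_smult_left)
  moreover have "mfun m (\<Sum>k\<in>A. f k) = (\<Sum>k\<in>A. mfun m (f k))" if "finite A" for A and f :: "nat \<Rightarrow> real poly"
    using that by induction (simp_all add: mfun_add)
  ultimately show ?thesis
    using assms by (simp add: mfun_smult)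
qed

lemma monom_mult_shift: "monom 1 k * pCons 0 p = monom (1::'a::comm_semiring_1) (Suc k) * p"
  by (simp add: monom_Suc)

section \<open>Monic orthogonal polynomials, from a matrix and from moments\<close>

text \<open>The monic orthogonal polynomials of a Jacobi matrix; \<open>n - 1\<close> truncates at 0, where the last
  coefficient is 0.\<close>
fun opoly :: "(nat \<Rightarrow> real) \<Rightarrow> (nat \<Rightarrow> real) \<Rightarrow> nat \<Rightarrow> real poly" where
  "opoly a b 0 = 1"
| "opoly a b (Suc n) = pCons 0 (opoly a b n) - smult (b (Suc n)) (opoly a b n)
     - smult (if n = 0 then 0 else (a n)\<^sup>2) (opoly a b (n - 1))"

text \<open>The same recurrence with the coefficients computed from the moments (Stieltjes procedure).\<close>
fun spoly :: "(nat \<Rightarrow> real) \<Rightarrow> nat \<Rightarrow> real poly" where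
  "spoly m 0 = 1"
| "spoly m (Suc n) = pCons 0 (spoly m n)
     - smult (mfun m (pCons 0 (spoly m n * spoly m n)) / mfun m (spoly m n * spoly m n)) (spoly m n)
     - smult (if n = 0 then 0
         else mfun m (spoly m n * spoly m n) / mfun m (spoly m (n - 1) * spoly m (n - 1)))
         (spoly m (n - 1))"

text \<open>The index shift matches matrix indices starting at 1: the diagonal entry b_n belongs to
  the polynomial of degree n - 1.\<close>

definition rec_b :: "(nat \<Rightarrow> real) \<Rightarrow> nat \<Rightarrow> real" where
  "rec_b m n = mfun m (pCons 0 (spoly m (n - 1) * spoly m (n - 1)))
     / mfun m (spoly m (n - 1) * spoly m (n - 1))"

text \<open>These are the squared off-diagonal entries. The value 0 at index 0 is the convention a_0
  = 0, which lets recurrences and Toda equations include the boundary case.\<close>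

definition rec_a2 :: "(nat \<Rightarrow> real) \<Rightarrow> nat \<Rightarrow> real" where
  "rec_a2 m n = (if n = 0 then 0
     else mfun m (spoly m n * spoly m n) / mfun m (spoly m (n - 1) * spoly m (n - 1)))"

definition rec_a :: "(nat \<Rightarrow> real) \<Rightarrow> nat \<Rightarrow> real" where
  "rec_a m n = sqrt (rec_a2 m n)"

lemma spoly_Suc: "spoly m (Suc n) = pCons 0 (spoly m n) - smult (rec_b m (Suc n)) (spoly m n)
     - smult (rec_a2 m n) (spoly m (n - 1))"
  by (simp add: rec_b_def rec_a2_def)

declare spoly.simps(2) [simp del] opoly.simps(2) [simp del]

lemma monic_recurrence_step:
  fixes p q :: "real poly"
  assumes "degree p = n" "coeff p n = 1" "degree q \<le> n"
  shows "degree (pCons 0 p - smult b p - smult c q) = Suc n"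
    and "coeff (pCons 0 p - smult b p - smult c q) (Suc n) = 1"
proof -
  have 0: "coeff p (Suc n) = 0" "coeff q (Suc n) = 0"
    using assms by (simp_all add: coeff_eq_0)
  then show *: "coeff (pCons 0 p - smult b p - smult c q) (Suc n) = 1"
    using assms by simp
  have "degree (pCons 0 p - smult b p - smult c q) \<le> Suc n"
  proof (intro degree_diff_le)
    show "degree (pCons 0 p) \<le> Suc n" using assms degree_pCons_le[of 0 p] by simp
    show "degree (smult b p) \<le> Suc n" "degree (smult c q) \<le> Suc n"
      using assms degree_smult_le[of b p] degree_smult_le[of c q] by simp_all
  qed
  then show "degree (pCons 0 p - smult b p - smult c q) = Suc n"
    using * le_degree[of "pCons 0 p - smult b p - smult c q" "Suc n"] by simp
qed

lemma spoly_monic: "degree (spoly m n) = n \<and> coeff (spoly m n) n = 1"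
proof (induction n rule: less_induct)
  case (less n)
  show ?case
  proof (cases n)
    case (Suc k)
    have "degree (spoly m (k - 1)) \<le> k" using less[of "k - 1"] Suc by simp
    then show ?thesis
      using monic_recurrence_step[of "spoly m k" k "spoly m (k - 1)" "rec_b m (Suc k)" "rec_a2 m k"]
        less[of k] Suc by (simp add: spoly_Suc)
  qed simp
qed

lemma opoly_monic: "degree (opoly a b n) = n \<and> coeff (opoly a b n) n = 1"
proof (induction n rule: less_induct)
  case (less n)
  show ?case
  proof (cases n)
    case (Suc k)
    have "degree (opoly a b (k - 1)) \<le> k" using less[of "k - 1"] Suc by simp
    then show ?thesis
      using monic_recurrence_step[of "opoly a b k" k "opoly a b (k - 1)" "b (Suc k)"
          "if k = 0 then 0 else (a k)\<^sup>2"]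
        less[of k] Suc by (simp add: opoly.simps(2))
  qed simp
qed

lemma spoly_nz: "spoly m n \<noteq> 0"
  using spoly_monic[of m n] by (metis coeff_0 zero_neq_one)

section \<open>The moment functional of a Jacobi matrix\<close>

lemma jacobi_power_Suc:
  assumes "j \<ge> 1"
  shows "jacobi_power a b (Suc k) i j =
    (if j = 1 then 0 else a (j - 1) * jacobi_power a b k i (j - 1))
      + b j * jacobi_power a b k i j + a j * jacobi_power a b k i (Suc j)"
proof (cases "j = 1")
  case True
  then show ?thesis by (simp add: jacobi_matrix_def numeral_2_eq_2)
next
  case False
  then obtain n where j: "j = Suc (Suc n)" using assms by (cases j; cases "j - 1") auto
  have "(\<Sum>l = 1..n. jacobi_power a b k i l * jacobi_matrix a b l j) = 0"
    by (rule sum.neutral) (auto simp: jacobi_matrix_def j)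
  then show ?thesis
    unfolding jacobi_power.simps
    by (simp add: j) (simp add: jacobi_matrix_def)
qed

text \<open>Each factor moves the index by at most one. Column k + 1 is therefore out of reach
  before step k, and at step k only the path 1, 2, ..., k + 1 leads there, with weight a_1 ...
  a_k.\<close>

lemma jacobi_power_band:
  "j > Suc k \<Longrightarrow> jacobi_power a b k 1 j = 0"
  "jacobi_power a b k 1 (Suc k) = (\<Prod>i = 1..k. a i)"
proof (induction k arbitrary: j)
  case (Suc k)
  { case 1
    then show ?case using Suc.IH by (simp add: jacobi_power_Suc del: jacobi_power.simps) }
  { case 2
    then show ?case using Suc.IH by (simp add: jacobi_power_Suc del: jacobi_power.simps) }
qed simp_all

text \<open>In matrix terms, pi_n(H) e_1 = (a_1 ... a_n) e_(n+1), so lambda^k pi_n is paired to the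
  entry (1, n+1) of H^k. The induction keeps k free because multiplication by lambda in the
  recurrence raises it.\<close>

lemma mfun_monom_opoly:
  "mfun (jacobi_moment a b) (monom 1 k * opoly a b n)
     = (\<Prod>i = 1..n. a i) * jacobi_power a b k 1 (Suc n)"
proof (induction n arbitrary: k rule: less_induct)
  case (less n)
  show ?case
  proof (cases n)
    case 0
    then show ?thesis by (simp add: jacobi_moment_def)
  next
    case (Suc j)
    have IH: "mfun (jacobi_moment a b) (monom 1 k * opoly a b j)
        = (\<Prod>i = 1..j. a i) * jacobi_power a b k 1 (Suc j)" for k
      using less Suc by simp
    \<comment> \<open>One factor a_j completes the product up to j. The case j = 0, where
      \<open>j - 1\<close> truncates, is removed by the zero coefficient.\<close>
    have IH': "(if j = 0 then 0 else (a j)\<^sup>2) * mfun (jacobi_moment a b) (monom 1 k * opoly a b (j - 1))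
        = (if j = 0 then 0 else (\<Prod>i = 1..j. a i) * a j * jacobi_power a b k 1 j)"
      using less[of "j - 1" k] Suc by (cases j) (simp_all add: power2_eq_square)
    have "monom 1 k * opoly a b n = monom 1 (Suc k) * opoly a b j
        - smult (b (Suc j)) (monom 1 k * opoly a b j)
        - smult (if j = 0 then 0 else (a j)\<^sup>2) (monom 1 k * opoly a b (j - 1))"
      by (simp only: Suc opoly.simps(2) right_diff_distrib mult_smult_right monom_mult_shift)
    then have "mfun (jacobi_moment a b) (monom 1 k * opoly a b n)
      = (\<Prod>i = 1..j. a i) * (jacobi_power a b (Suc k) 1 (Suc j)
          - b (Suc j) * jacobi_power a b k 1 (Suc j)
          - (if j = 0 then 0 else a j * jacobi_power a b k 1 j))"
      by (simp only: mfun_simps IH IH') (simp add: algebra_simps)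
    also have "jacobi_power a b (Suc k) 1 (Suc j) - b (Suc j) * jacobi_power a b k 1 (Suc j)
          - (if j = 0 then 0 else a j * jacobi_power a b k 1 j) = a (Suc j) * jacobi_power a b k 1 (Suc (Suc j))"
      by (simp add: jacobi_power_Suc del: jacobi_power.simps)
    finally show ?thesis by (simp add: Suc)
  qed
qed

lemma mfun_opoly_degree_less:
  assumes "degree p < n"
  shows "mfun (jacobi_moment a b) (p * opoly a b n) = 0"
  by (rule mfun_mult_eq_0)
    (use assms in \<open>simp add: mfun_monom_opoly jacobi_power_band(1)[unfolded One_nat_def]
       del: jacobi_power.simps\<close>)

text \<open>Subtracting the term of degree n leaves a polynomial orthogonal to pi_n, so only the
  coefficient of lambda^n is felt.\<close>

lemma mfun_opoly_degree_eq:
  assumes "degree p \<le> n"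
  shows "mfun (jacobi_moment a b) (p * opoly a b n) = coeff p n * (\<Prod>i = 1..n. a i)\<^sup>2"
proof -
  define r where "r = p - monom (coeff p n) n"
  have "coeff r i = 0" if "i \<ge> n" for i
    using that assms by (auto simp: r_def coeff_eq_0)
  then have r0: "mfun (jacobi_moment a b) (r * opoly a b n) = 0"
  proof (cases "r = 0")
    case False
    then have "degree r < n"
      using \<open>\<And>i. i \<ge> n \<Longrightarrow> coeff r i = 0\<close> by (meson leading_coeff_0_iff not_le)
    then show ?thesis by (rule mfun_opoly_degree_less)
  qed simp
  have "p = r + smult (coeff p n) (monom 1 n)" by (simp add: r_def smult_monom)
  then have "mfun (jacobi_moment a b) (p * opoly a b n)
      = mfun (jacobi_moment a b) (r * opoly a b n)
        + coeff p n * mfun (jacobi_moment a b) (monom 1 n * opoly a b n)"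
    by (metis distrib_right mfun_add mfun_smult mult_smult_left)
  then show ?thesis
    by (simp add: r0 mfun_monom_opoly jacobi_power_band(2)[unfolded One_nat_def] power2_eq_square
        del: jacobi_power.simps)
qed

lemma mfun_opoly_square:
  "mfun (jacobi_moment a b) (opoly a b n * opoly a b n) = (\<Prod>i = 1..n. a i)\<^sup>2"
  using opoly_monic[of a b n] by (simp add: mfun_opoly_degree_eq)

text \<open>Writing lambda pi_n^2 as pi_n times lambda pi_n and expanding by the recurrence,
  orthogonality leaves only the diagonal term.\<close>

lemma mfun_shift_opoly_square:
  "mfun (jacobi_moment a b) (pCons 0 (opoly a b n * opoly a b n))
     = b (Suc n) * (\<Prod>i = 1..n. a i)\<^sup>2"
proof -
  have "pCons 0 (opoly a b n * opoly a b n) = opoly a b n * opoly a b (Suc n)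
    + smult (b (Suc n)) (opoly a b n * opoly a b n)
    + smult (if n = 0 then 0 else (a n)\<^sup>2) (opoly a b (n - 1) * opoly a b n)"
    by (simp add: opoly.simps(2) algebra_simps)
  then show ?thesis
    using opoly_monic[of a b n] opoly_monic[of a b "n - 1"]
    by (auto simp: mfun_simps mfun_opoly_square mfun_opoly_degree_less)
qed

text \<open>The squared norm of pi_n is (a_1 ... a_n)^2, so quotients of consecutive norms return
  a_n^2 and the Stieltjes procedure reproduces the recurrence of the matrix. This is the uniqueness
  half of the correspondence between matrices and moments.\<close>

lemma jacobi_moment_determines:
  assumes a: "\<And>n. n \<ge> 1 \<Longrightarrow> a n > 0"
  shows "spoly (jacobi_moment a b) n = opoly a b n"
    and "n \<ge> 1 \<Longrightarrow> rec_b (jacobi_moment a b) n = b n"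
    and "n \<ge> 1 \<Longrightarrow> rec_a (jacobi_moment a b) n = a n"
proof -
  let ?m = "jacobi_moment a b"
  have pr: "(\<Prod>i = 1..n. a i) > 0" for n
    using a by (intro prod_pos) auto
  have pr0: "(\<Prod>i = 1..n. a i) \<noteq> 0" for n using pr[of n] by linarith
  have quot: "(\<Prod>i = 1..n. a i)\<^sup>2 / (\<Prod>i = 1..n - 1. a i)\<^sup>2 = (a n)\<^sup>2" if "n \<ge> 1" for n
    using that pr0[of "n - 1"] by (cases n) (simp_all add: power_mult_distrib)
  have sp: "spoly ?m n = opoly a b n" for n
  proof (induction n rule: less_induct)
    case (less n)
    show ?case
    proof (cases n)
      case (Suc k)
      have "spoly ?m k = opoly a b k" "spoly ?m (k - 1) = opoly a b (k - 1)"
        using less Suc by simp_all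
      then show ?thesis
        using quot[of k] pr0[of k]
        by (simp add: Suc spoly.simps(2) opoly.simps(2) mfun_opoly_square mfun_shift_opoly_square
            del: One_nat_def)
    qed simp
  qed
  then show "spoly ?m n = opoly a b n" .
  show "rec_b ?m n = b n" if "n \<ge> 1"
    using that pr0[of "n - 1"]
    by (simp add: rec_b_def sp mfun_opoly_square mfun_shift_opoly_square)
  show "rec_a ?m n = a n" if "n \<ge> 1"
    using that quot[of n] a[of n]
    by (simp add: rec_a_def rec_a2_def sp mfun_opoly_square del: One_nat_def)
qed

text \<open>All coefficients are quotients of values of the functional, hence homogeneous of degree
  0. The flow can thus be studied for unnormalised moments, without the factor Omega.\<close>

lemma rec_scale:
  assumes "c \<noteq> 0"
  shows "spoly (\<lambda>k. m k / c) n = spoly m n"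
    and "rec_a (\<lambda>k. m k / c) n = rec_a m n"
    and "rec_b (\<lambda>k. m k / c) n = rec_b m n"
proof -
  have sp: "spoly (\<lambda>k. m k / c) n = spoly m n" for n
  proof (induction n rule: less_induct)
    case (less n)
    show ?case
      by (cases n) (use less assms in \<open>simp_all add: spoly.simps(2) mfun_divide\<close>)
  qed
  then show "spoly (\<lambda>k. m k / c) n = spoly m n" .
  show "rec_a (\<lambda>k. m k / c) n = rec_a m n" "rec_b (\<lambda>k. m k / c) n = rec_b m n"
    using assms by (simp_all add: rec_a_def rec_a2_def rec_b_def sp mfun_divide)
qed

section \<open>Positive definite moment sequences\<close>

text \<open>This is positive definiteness of all Hankel matrices m_(i+j); it makes every squared
  norm \<open>h n\<close> a legitimate divisor.\<close>

locale positive_moments =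
  fixes m :: "nat \<Rightarrow> real"
  assumes pos: "p \<noteq> 0 \<Longrightarrow> mfun m (p * p) > 0"
begin

abbreviation "h n \<equiv> mfun m (spoly m n * spoly m n)"

lemma h_pos: "h n > 0"
  by (simp add: pos spoly_nz)

lemma m0_pos: "m 0 > 0"
  using h_pos[of 0] by simp

lemma rec_a2_h: "n \<ge> 1 \<Longrightarrow> rec_a2 m n * h (n - 1) = h n"
  using h_pos[of "n - 1"] by (simp add: rec_a2_def)

lemma rec_a2_0 [simp]: "rec_a2 m 0 = 0"
  by (simp add: rec_a2_def)

lemma rec_b_h: "rec_b m (Suc n) * h n = mfun m (pCons 0 (spoly m n * spoly m n))"
  using h_pos[of n] by (simp add: rec_b_def)

lemma rec_a2_pos: "n \<ge> 1 \<Longrightarrow> rec_a2 m n > 0"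
  using h_pos by (simp add: rec_a2_def)

lemma rec_a_pos: "n \<ge> 1 \<Longrightarrow> rec_a m n > 0"
  by (simp add: rec_a_def rec_a2_pos)

lemma rec_a_square: "(rec_a m n)\<^sup>2 = rec_a2 m n"
  using rec_a2_pos[of n] by (cases "n = 0") (simp_all add: rec_a_def)

lemma shift_spoly: "pCons 0 (spoly m n) = spoly m (Suc n) + smult (rec_b m (Suc n)) (spoly m n)
     + smult (rec_a2 m n) (spoly m (n - 1))"
  by (simp add: spoly_Suc)

text \<open>With n = k + 1, the two recurrence coefficients are chosen to annihilate the products
  with pi_k and pi_(k-1). For smaller i, multiplication by lambda is moved onto pi_i, which keeps
  the degree below k.\<close>

lemma spoly_orthogonal_less: "i < n \<Longrightarrow> mfun m (spoly m n * spoly m i) = 0"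
proof (induction n arbitrary: i rule: less_induct)
  case (less n)
  then obtain k where n: "n = Suc k" by (cases n) auto
  have IH: "mfun m (spoly m k * spoly m j) = 0" if "j < k" for j
    using less.IH[of k j] that n by simp
  have IH': "mfun m (spoly m (k - 1) * spoly m j) = 0" if "j < k - 1" for j
    using less.IH[of "k - 1" j] that n by simp
  have exp: "mfun m (spoly m n * spoly m i) = mfun m (spoly m k * pCons 0 (spoly m i))
      - rec_b m (Suc k) * mfun m (spoly m k * spoly m i)
      - rec_a2 m k * mfun m (spoly m (k - 1) * spoly m i)"
    by (simp add: n spoly_Suc mfun_simps algebra_simps)
  consider "i = k" | "i = k - 1" "k \<ge> 1" | "i < k - 1" using less.prems n by linarith
  then show ?case
  proof cases
    case 1
    \<comment> \<open>For k = 0 the truncated index gives pi_0 itself, and the term disappears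
      because \<open>rec_a2 m 0\<close> is 0.\<close>
    have "rec_a2 m k * mfun m (spoly m (k - 1) * spoly m k) = 0"
      using IH[of "k - 1"] by (cases k) (simp_all add: mult.commute)
    then show ?thesis using exp 1 rec_b_h[of k] by simp
  next
    case 2
    have "rec_a2 m (k - 1) * mfun m (spoly m k * spoly m (k - 1 - 1)) = 0"
      using IH[of "k - 1 - 1"] 2 by (cases "k - 1 = 0") simp_all
    then have "mfun m (spoly m k * pCons 0 (spoly m (k - 1))) = h k"
      unfolding shift_spoly[of "k - 1"] using IH[of "k - 1"] 2
      by (simp add: mfun_simps distrib_left)
    then show ?thesis using exp 2 IH[of "k - 1"] rec_a2_h[of k] by simp
  next
    case 3
    then have "mfun m (spoly m k * pCons 0 (spoly m i)) = 0"
      unfolding shift_spoly[of i] by (simp add: mfun_simps distrib_left IH)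
    then show ?thesis using exp 3 IH[of i] IH'[of i] by simp
  qed
qed

lemma spoly_orthogonal: "i \<noteq> n \<Longrightarrow> mfun m (spoly m n * spoly m i) = 0"
  using spoly_orthogonal_less[of i n] spoly_orthogonal_less[of n i]
  by (cases "i < n") (auto simp: mult.commute)

lemma mfun_shift_consecutive: "mfun m (pCons 0 (spoly m (Suc n) * spoly m n)) = h (Suc n)"
proof -
  have "pCons 0 (spoly m (Suc n) * spoly m n) = spoly m (Suc n) * pCons 0 (spoly m n)" by simp
  also have "mfun m \<dots> = h (Suc n)"
    unfolding shift_spoly[of n] by (simp add: mfun_simps algebra_simps spoly_orthogonal)
  finally show ?thesis .
qed

text \<open>Parseval for lambda pi_n = pi_(n+1) + b_(n+1) pi_n + a_n^2 pi_(n-1), with all norms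
  converted to \<open>h n\<close> by h_n = a_n^2 h_(n-1).\<close>

lemma mfun_shift2_square:
  "mfun m (pCons 0 (pCons 0 (spoly m n * spoly m n)))
     = (rec_a2 m (Suc n) + (rec_b m (Suc n))\<^sup>2 + rec_a2 m n) * h n"
proof -
  have a: "rec_a2 m n * mfun m (spoly m (n - 1) * spoly m j) = (if j = n - 1 then h n else 0)" if "n \<ge> 1" for j
    using that spoly_orthogonal[of j "n - 1"] rec_a2_h[of n] by simp
  have "pCons 0 (pCons 0 (spoly m n * spoly m n)) = pCons 0 (spoly m n) * pCons 0 (spoly m n)" by simp
  also have "mfun m \<dots> = h (Suc n) + (rec_b m (Suc n))\<^sup>2 * h n + rec_a2 m n * h n"
  proof (cases "n = 0")
    case True
    then show ?thesis unfolding shift_spoly[of n]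
      by (simp add: mfun_simps distrib_left distrib_right spoly_orthogonal power2_eq_square mult.assoc
         del: spoly.simps)
  next
    case False
    then show ?thesis unfolding shift_spoly[of n]
      using rec_a2_h[of n]
      by (simp add: mfun_simps distrib_left distrib_right spoly_orthogonal power2_eq_square mult.assoc)
  qed
  also have "h (Suc n) = rec_a2 m (Suc n) * h n" using rec_a2_h[of "Suc n"] by simp
  finally show ?thesis by (simp add: algebra_simps)
qed

lemma opoly_rec: "opoly (rec_a m) (rec_b m) n = spoly m n"
proof (induction n rule: less_induct)
  case (less n)
  show ?case
  proof (cases n)
    case (Suc k)
    have "opoly (rec_a m) (rec_b m) k = spoly m k" "opoly (rec_a m) (rec_b m) (k - 1) = spoly m (k - 1)"
      using less Suc by simp_all
    then show ?thesis by (simp add: Suc spoly_Suc opoly.simps(2) rec_a_square)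
  qed simp
qed

text \<open>Both functionals vanish on \<open>spoly m n\<close> for \<open>n \<ge> 1\<close>, and these polynomials together with 1
  span all polynomials.\<close>
lemma jacobi_moment_rec: "jacobi_moment (rec_a m) (rec_b m) k = m k / m 0"
proof (induction k rule: less_induct)
  case (less k)
  let ?m = "\<lambda>k. m k / m 0"
  let ?j = "jacobi_moment (rec_a m) (rec_b m)"
  show ?case
  proof (cases "k = 0")
    case True
    then show ?thesis using m0_pos by (simp add: jacobi_moment_def)
  next
    case False
    have v1: "mfun ?m (spoly m k) = 0"
      using spoly_orthogonal[of 0 k] False by (simp add: mfun_divide)
    have v2: "mfun ?j (spoly m k) = 0"
      using mfun_opoly_degree_less[of 1 k "rec_a m" "rec_b m"] False by (simp add: opoly_rec)
    \<comment> \<open>Since pi_k is monic, a functional vanishing on it has its k-th moment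
      determined by the lower ones.\<close>
    have e: "mfun f (spoly m k) = f k + (\<Sum>i<k. coeff (spoly m k) i * f i)" for f
      using spoly_monic[of m k] by (simp add: mfun_def lessThan_Suc_atMost[symmetric])
    show ?thesis using v1 v2 unfolding e using less by simp
  qed
qed

lemma jacobi_unique:
  assumes "\<And>n. n \<ge> 1 \<Longrightarrow> a n > 0" "\<And>k. jacobi_moment a b k = m k / m 0" "n \<ge> 1"
  shows "a n = rec_a m n" "b n = rec_b m n"
proof -
  have "jacobi_moment a b = (\<lambda>k. m k / m 0)" using assms(2) by blast
  then show "a n = rec_a m n" "b n = rec_b m n"
    using jacobi_moment_determines[where a = a and b = b and n = n] assms(1,3) rec_scale[of "m 0" m n] m0_pos by simp_all
qed

end

section \<open>The Toda flow\<close>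

text \<open>Polynomials are differentiated coefficientwise; along a family of bounded degree this
  suffices for every value of the moment functional.\<close>

definition has_coeff_deriv :: "(real \<Rightarrow> real poly) \<Rightarrow> real poly \<Rightarrow> real filter \<Rightarrow> bool" where
  "has_coeff_deriv p q F \<longleftrightarrow> (\<forall>i. ((\<lambda>t. coeff (p t) i) has_field_derivative coeff q i) F)"

lemma has_coeff_deriv_const: "has_coeff_deriv (\<lambda>_. p) 0 F"
  by (simp add: has_coeff_deriv_def)

lemma has_coeff_deriv_shift: "has_coeff_deriv p q F \<Longrightarrow> has_coeff_deriv (\<lambda>t. pCons 0 (p t)) (pCons 0 q) F"
  unfolding has_coeff_deriv_def
proof
  fix i assume "\<forall>i. ((\<lambda>t. coeff (p t) i) has_field_derivative coeff q i) F"
  then show "((\<lambda>t. coeff (pCons 0 (p t)) i) has_field_derivative coeff (pCons 0 q) i) F"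
    by (cases i) auto
qed

lemma has_coeff_deriv_diff:
  "has_coeff_deriv p p' (at t within S) \<Longrightarrow> has_coeff_deriv q q' (at t within S) \<Longrightarrow>
    has_coeff_deriv (\<lambda>t. p t - q t) (p' - q') (at t within S)"
  by (auto simp: has_coeff_deriv_def intro!: derivative_eq_intros)

lemma has_coeff_deriv_smult:
  assumes "(f has_field_derivative f') (at t within S)" "has_coeff_deriv p p' (at t within S)"
  shows "has_coeff_deriv (\<lambda>t. smult (f t) (p t)) (smult f' (p t) + smult (f t) p') (at t within S)"
  using assms unfolding has_coeff_deriv_def
  by (auto intro!: derivative_eq_intros)

lemma has_coeff_deriv_mult:
  assumes "has_coeff_deriv p p' (at t within S)" "has_coeff_deriv q q' (at t within S)"
  shows "has_coeff_deriv (\<lambda>t. p t * q t) (p' * q t + p t * q') (at t within S)"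
  using assms unfolding has_coeff_deriv_def
  by (auto simp: coeff_mult sum.distrib[symmetric] intro!: derivative_eq_intros sum.cong)

text \<open>Product rule: besides the change of the polynomial, the law m_i' = 2 m_(i+1) acts as
  multiplication by 2 lambda, the logarithmic derivative of the weight e^(2 lambda t). The bound
  \<open>N\<close> makes the range of summation independent of t.\<close>

lemma mfun_has_derivative:
  assumes m: "\<And>i. (m i has_real_derivative 2 * m (Suc i) t) (at t within S)"
    and p: "has_coeff_deriv p q (at t within S)"
    and deg: "\<And>t. degree (p t) \<le> N" "degree q \<le> N"
  shows "((\<lambda>t. mfun (\<lambda>i. m i t) (p t)) has_real_derivative
     mfun (\<lambda>i. m i t) q + 2 * mfun (\<lambda>i. m i t) (pCons 0 (p t))) (at t within S)"
proof -
  have shift: "mfun (\<lambda>i. m i t) (pCons 0 (p t)) = (\<Sum>i\<le>N. coeff (p t) i * m (Suc i) t)"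
    using mfun_eq_sum[of "pCons 0 (p t)" "Suc N" "\<lambda>i. m i t"] deg(1)[of t]
      degree_pCons_le[of 0 "p t"]
    by (simp add: sum.atMost_Suc_shift del: sum.atMost_Suc)
  have "((\<lambda>t. \<Sum>i\<le>N. coeff (p t) i * m i t) has_real_derivative
      (\<Sum>i\<le>N. coeff q i * m i t + 2 * m (Suc i) t * coeff (p t) i)) (at t within S)"
    using p m unfolding has_coeff_deriv_def
    by (intro DERIV_sum DERIV_mult) auto
  then show ?thesis
    unfolding mfun_eq_sum[OF deg(1)] mfun_eq_sum[OF deg(2)] shift
    by (simp add: sum.distrib sum_distrib_left mult.commute mult.left_commute)
qed

section \<open>The flow of the orthogonal polynomials and of the recurrence coefficients\<close>

locale moment_flow =
  fixes m :: "nat \<Rightarrow> real \<Rightarrow> real" and S :: "real set"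
  assumes deriv: "t \<in> S \<Longrightarrow> (m i has_real_derivative 2 * m (Suc i) t) (at t within S)"
    and positive: "t \<in> S \<Longrightarrow> positive_moments (\<lambda>i. m i t)"
begin

abbreviation "M t \<equiv> (\<lambda>i. m i t)"
abbreviation "P n t \<equiv> spoly (M t) n"
abbreviation "A2 n t \<equiv> rec_a2 (M t) n"
abbreviation "B n t \<equiv> rec_b (M t) n"

text \<open>Stated for a single n and t, so that the derivatives of the recurrence coefficients can
  assume it at indices already reached by the induction in the lemma of the same name.\<close>

definition "spoly_flow n t \<longleftrightarrow> has_coeff_deriv (P n) (smult (- 2 * A2 n t) (P (n - 1) t)) (at t within S)"

lemma spoly_square_flow:
  assumes "spoly_flow n t"
  shows "has_coeff_deriv (\<lambda>t. P n t * P n t) (smult (- 4 * A2 n t) (P n t * P (n - 1) t)) (at t within S)"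
proof -
  have eq: "smult (- 2 * A2 n t) (P (n - 1) t) * P n t + P n t * smult (- 2 * A2 n t) (P (n - 1) t)
     = smult (- 4 * A2 n t) (P n t * P (n - 1) t)"
    by (simp only: mult_smult_left mult_smult_right mult.commute[of "P (n - 1) t"] smult_add_left[symmetric]) simp
  note d = assms[unfolded spoly_flow_def]
  show ?thesis
    unfolding eq[symmetric] by (rule has_coeff_deriv_mult[OF d d])
qed

text \<open>The derivative of pi_n is a multiple of pi_(n-1), which is orthogonal to pi_n. Only the
  change of the functional counts, and it yields 2 L(lambda pi_n^2).\<close>

lemma h_flow:
  assumes t: "t \<in> S" and fl: "spoly_flow n t"
  shows "((\<lambda>t. mfun (M t) (P n t * P n t)) has_real_derivative
    2 * B (Suc n) t * mfun (M t) (P n t * P n t)) (at t within S)"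
proof -
  interpret positive_moments "M t" using t by (rule positive)
  have deg: "degree (P n t * P n t) \<le> 2 * n" for t
    using degree_mult_le[of "P n t" "P n t"] spoly_monic[of "M t" n] by simp
  have "degree (P n t * P (n - 1) t) \<le> 2 * n"
    using degree_mult_le[of "P n t" "P (n - 1) t"] spoly_monic[of "M t" n] spoly_monic[of "M t" "n - 1"]
    by simp
  then have deg': "degree (smult (- 4 * A2 n t) (P n t * P (n - 1) t)) \<le> 2 * n"
    using degree_smult_le le_trans by blast
  have "A2 n t * mfun (M t) (P n t * P (n - 1) t) = 0"
    by (cases n) (simp_all add: spoly_orthogonal)
  then show ?thesis
    using mfun_has_derivative[where m = m, OF deriv[OF t] spoly_square_flow[OF fl] deg deg']
    by (auto simp: mfun_smult rec_b_h[symmetric] algebra_simps)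
qed

text \<open>In the quotient rule the squares of b_(n+1) cancel. The change of pi_n contributes -4
  a_n^2 and the second moment contributes 2 a_(n+1)^2 + 2 a_n^2.\<close>

lemma rec_b_flow:
  assumes t: "t \<in> S" and fl: "spoly_flow n t"
  shows "((\<lambda>t. B (Suc n) t) has_real_derivative 2 * (A2 (Suc n) t - A2 n t)) (at t within S)"
proof -
  interpret positive_moments "M t" using t by (rule positive)
  have deg: "degree (pCons 0 (P n t * P n t)) \<le> Suc (2 * n)" for t
    using degree_mult_le[of "P n t" "P n t"] spoly_monic[of "M t" n]
      degree_pCons_le[of 0 "P n t * P n t"] by simp
  let ?q = "smult (- 4 * A2 n t) (P n t * P (n - 1) t)"
  have "degree (P n t * P (n - 1) t) \<le> 2 * n"
    using degree_mult_le[of "P n t" "P (n - 1) t"] spoly_monic[of "M t" n] spoly_monic[of "M t" "n - 1"]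
    by simp
  then have "degree ?q \<le> 2 * n"
    using degree_smult_le le_trans by blast
  then have deg': "degree (pCons 0 ?q) \<le> Suc (2 * n)"
    using degree_pCons_le[of 0 ?q] by linarith
  have q: "mfun (M t) (pCons 0 ?q) = - 4 * A2 n t * h n"
  proof (cases n)
    case (Suc k)
    have "pCons 0 ?q = smult (- 4 * A2 n t) (pCons 0 (P n t * P (n - 1) t))" by simp
    then show ?thesis using mfun_shift_consecutive[of k] Suc by (simp only: mfun_smult) simp
  qed simp
  have num: "((\<lambda>t. mfun (M t) (pCons 0 (P n t * P n t))) has_real_derivative
     - 4 * A2 n t * h n + 2 * ((A2 (Suc n) t + (B (Suc n) t)\<^sup>2 + A2 n t) * h n)) (at t within S)"
    using mfun_has_derivative[where m = m, OF deriv[OF t] has_coeff_deriv_shift[OF spoly_square_flow[OF fl]] deg deg']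
    unfolding q mfun_shift2_square .
  have B: "B (Suc n) = (\<lambda>t. mfun (M t) (pCons 0 (P n t * P n t)) / mfun (M t) (P n t * P n t))"
    by (simp add: rec_b_def fun_eq_iff)
  have "mfun (M t) (pCons 0 (P n t * P n t)) = B (Suc n) t * h n"
    by (simp add: rec_b_h)
  then show ?thesis
    unfolding B using h_pos[of n]
    by (intro DERIV_cong[OF DERIV_divide[OF num h_flow[OF t fl]]])
       (simp_all add: field_simps power2_eq_square)
qed

text \<open>The logarithmic derivative of \<open>h n\<close> is 2 b_(n+1), and a_n^2 is the quotient
  of consecutive norms.\<close>

lemma rec_a2_flow:
  assumes t: "t \<in> S" and fl: "spoly_flow n t" "spoly_flow (n - 1) t" and "n \<ge> 1"
  shows "((\<lambda>t. A2 n t) has_real_derivative 2 * A2 n t * (B (Suc n) t - B n t)) (at t within S)"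
proof -
  interpret positive_moments "M t" using t by (rule positive)
  have A: "A2 n = (\<lambda>t. mfun (M t) (P n t * P n t) / mfun (M t) (P (n - 1) t * P (n - 1) t))"
    using \<open>n \<ge> 1\<close> by (simp add: rec_a2_def fun_eq_iff)
  have "Suc (n - 1) = n" "h n = A2 n t * h (n - 1)" using \<open>n \<ge> 1\<close> rec_a2_h by simp_all
  then show ?thesis
    unfolding A using h_pos[of "n - 1"]
    by (intro DERIV_cong[OF DERIV_divide[OF h_flow[OF t fl(1)] h_flow[OF t fl(2)]]])
       (simp_all add: field_simps)
qed

lemma spoly_flow:
  assumes t: "t \<in> S"
  shows "spoly_flow n t"
proof (induction n rule: less_induct)
  case (less n)
  interpret positive_moments "M t" using t by (rule positive)
  show ?case
  proof (cases n)
    case 0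
    then show ?thesis using has_coeff_deriv_const[of 1] by (simp add: spoly_flow_def)
  next
    case (Suc k)
    have fl: "spoly_flow k t" "spoly_flow (k - 1) t" using less Suc by simp_all
    note d = fl[unfolded spoly_flow_def]
    have a: "((\<lambda>t. A2 k t) has_real_derivative 2 * A2 k t * (B (Suc k) t - B k t)) (at t within S)"
    proof (cases k)
      case 0
      then show ?thesis by (simp add: rec_a2_def)
    next
      case (Suc j)
      then show ?thesis using rec_a2_flow[OF t fl] by simp
    qed
    \<comment> \<open>The left side is the derivative of the recurrence. Substituting the recurrence
      for lambda pi_(k-1) cancels everything involving pi_(k-1) and pi_(k-2).\<close>
    have eq: "pCons 0 (smult (- 2 * A2 k t) (P (k - 1) t))
       - (smult (2 * (A2 (Suc k) t - A2 k t)) (P k t) + smult (B (Suc k) t) (smult (- 2 * A2 k t) (P (k - 1) t)))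
       - (smult (2 * A2 k t * (B (Suc k) t - B k t)) (P (k - 1) t)
           + smult (A2 k t) (smult (- 2 * A2 (k - 1) t) (P (k - 1 - 1) t)))
       = smult (- 2 * A2 (Suc k) t) (P k t)" (is "?l = ?r")
    proof (cases k)
      case 0
      then show ?thesis by (simp add: smult_diff_left)
    next
      case (Suc j)
      have sh: "pCons 0 (smult (- 2 * A2 k t) (P j t)) = smult (- 2 * A2 k t) (pCons 0 (P j t))" by simp
      have "coeff ?l i = coeff ?r i" for i
        unfolding Suc diff_Suc_1 sh[unfolded Suc] shift_spoly[of j]
        by (simp add: algebra_simps)
      then show ?thesis by (simp add: poly_eq_iff)
    qed
    have "has_coeff_deriv (\<lambda>t. pCons 0 (P k t) - smult (B (Suc k) t) (P k t) - smult (A2 k t) (P (k - 1) t))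
       (smult (- 2 * A2 (Suc k) t) (P k t)) (at t within S)"
      unfolding eq[symmetric]
      by (intro has_coeff_deriv_diff has_coeff_deriv_shift has_coeff_deriv_smult
          rec_b_flow[OF t fl(1)] a d)
    then show ?thesis by (simp add: Suc spoly_flow_def spoly_Suc)
  qed
qed

lemma toda_b:
  assumes "t \<in> S" "n \<ge> 1"
  shows "((\<lambda>t. rec_b (M t) n) has_real_derivative
     2 * ((rec_a (M t) n)\<^sup>2 - (rec_a (M t) (n - 1))\<^sup>2)) (at t within S)"
  using rec_b_flow[OF assms(1) spoly_flow, of "n - 1"] assms
    positive_moments.rec_a_square[OF positive] by simp

lemma toda_a:
  assumes t: "t \<in> S" and n: "n \<ge> 1"
  shows "((\<lambda>t. rec_a (M t) n) has_real_derivative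
     rec_a (M t) n * (rec_b (M t) (Suc n) - rec_b (M t) n)) (at t within S)"
proof -
  interpret positive_moments "M t" using t by (rule positive)
  have pos: "A2 n t > 0" using n by (rule rec_a2_pos)
  \<comment> \<open>The chain rule for the square root halves the logarithmic derivative, which
    turns the equation for a_n^2 into the one for a_n.\<close>
  have "inverse (sqrt c) / 2 * (2 * c * x) = sqrt c * x" if "c > 0" for c x :: real
  proof -
    have "inverse (sqrt c) / 2 * (2 * c * x) = (c / sqrt c) * x"
      using that by (simp add: field_simps)
    then show ?thesis using that by (simp add: real_div_sqrt)
  qed
  from this[OF pos] show ?thesis
    unfolding rec_a_def
    by (intro DERIV_cong[OF DERIV_chain2[OF DERIV_real_sqrt[OF pos] rec_a2_flow[OF t spoly_flow spoly_flow n]]] t)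
qed

end

section \<open>The Hilbert space\<close>

lemma l2_add:
  assumes "x \<in> l2" "y \<in> l2"
  shows "x + y \<in> l2"
proof -
  have s: "summable (\<lambda>n. 2 * (cmod (x n))\<^sup>2 + 2 * (cmod (y n))\<^sup>2)"
    using assms by (intro summable_add summable_mult) (auto simp: l2_def)
  have "(cmod (x n + y n))\<^sup>2 \<le> 2 * (cmod (x n))\<^sup>2 + 2 * (cmod (y n))\<^sup>2" for n
  proof -
    have "(cmod (x n + y n))\<^sup>2 \<le> (cmod (x n) + cmod (y n))\<^sup>2"
      by (intro power_mono norm_triangle_ineq) simp
    also have "\<dots> \<le> 2 * (cmod (x n))\<^sup>2 + 2 * (cmod (y n))\<^sup>2"
      using sum_squares_bound[of "cmod (x n)" "cmod (y n)"] by (simp add: power2_sum)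
    finally show ?thesis .
  qed
  then have "summable (\<lambda>n. (cmod (x n + y n))\<^sup>2)"
    by (intro summable_comparison_test'[OF s]) auto
  then show ?thesis using assms by (simp add: l2_def)
qed

lemma l2_scale: "x \<in> l2 \<Longrightarrow> cscale c x \<in> l2"
  by (simp add: l2_def cscale_def norm_mult power_mult_distrib summable_mult)

lemma cseq_diff_eq: "x - y = x + cscale (-1) y"
  by (simp add: cscale_def fun_eq_iff)

lemma l2_diff: "x \<in> l2 \<Longrightarrow> y \<in> l2 \<Longrightarrow> x - y \<in> l2"
  unfolding cseq_diff_eq by (intro l2_add l2_scale)

lemma l2_summable_inner:
  assumes "x \<in> l2" "y \<in> l2"
  shows "summable (\<lambda>n. cmod (x n * cnj (y n)))"
proof -
  have s: "summable (\<lambda>n. (cmod (x n))\<^sup>2 + (cmod (y n))\<^sup>2)"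
    using assms by (intro summable_add) (auto simp: l2_def)
  have "cmod (x n * cnj (y n)) \<le> (cmod (x n))\<^sup>2 + (cmod (y n))\<^sup>2" for n
    using sum_squares_bound[of "cmod (x n)" "cmod (y n)"]
      mult_nonneg_nonneg[OF norm_ge_zero norm_ge_zero, of "x n" "y n"]
    by (simp only: norm_mult complex_mod_cnj)
  then show ?thesis
    by (intro summable_comparison_test'[OF s]) auto
qed

lemmas l2_summable = l2_summable_inner[THEN summable_norm_cancel]

lemma l2_inner_add_left:
  "x \<in> l2 \<Longrightarrow> y \<in> l2 \<Longrightarrow> z \<in> l2 \<Longrightarrow> l2_inner (x + y) z = l2_inner x z + l2_inner y z"
  by (simp add: l2_inner_def suminf_add l2_summable algebra_simps)

lemma l2_inner_add_right:
  "x \<in> l2 \<Longrightarrow> y \<in> l2 \<Longrightarrow> z \<in> l2 \<Longrightarrow> l2_inner x (y + z) = l2_inner x y + l2_inner x z"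
  by (simp add: l2_inner_def suminf_add l2_summable algebra_simps)

lemma l2_inner_scale_left:
  "x \<in> l2 \<Longrightarrow> y \<in> l2 \<Longrightarrow> l2_inner (cscale c x) y = c * l2_inner x y"
  using suminf_mult[OF l2_summable, of x y c] by (simp add: l2_inner_def cscale_def mult.assoc)

lemma l2_inner_scale_right:
  "x \<in> l2 \<Longrightarrow> y \<in> l2 \<Longrightarrow> l2_inner x (cscale c y) = cnj c * l2_inner x y"
  using suminf_mult[OF l2_summable, of x y "cnj c"]
  by (simp add: l2_inner_def cscale_def mult.left_commute)

lemma l2_inner_diff_left:
  "x \<in> l2 \<Longrightarrow> y \<in> l2 \<Longrightarrow> z \<in> l2 \<Longrightarrow> l2_inner (x - y) z = l2_inner x z - l2_inner y z"
  using l2_inner_add_left[of x "cscale (-1) y" z] l2_inner_scale_left[of y z "-1"] l2_scale[of y "-1"]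
  by (simp only: cseq_diff_eq) simp

lemma l2_inner_diff_right:
  "x \<in> l2 \<Longrightarrow> y \<in> l2 \<Longrightarrow> z \<in> l2 \<Longrightarrow> l2_inner x (y - z) = l2_inner x y - l2_inner x z"
  using l2_inner_add_right[of x y "cscale (-1) z"] l2_inner_scale_right[of x z "-1"] l2_scale[of z "-1"]
  by (simp only: cseq_diff_eq) simp

lemmas l2_inner_simps = l2_inner_diff_left l2_inner_diff_right l2_inner_add_left l2_inner_add_right l2_inner_scale_left l2_inner_scale_right

lemma l2_inner_commute:
  assumes "x \<in> l2" "y \<in> l2"
  shows "l2_inner y x = cnj (l2_inner x y)"
proof -
  have "(\<lambda>n. x n * cnj (y n)) sums l2_inner x y"
    unfolding l2_inner_def using l2_summable[OF assms] by (rule summable_sums)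
  then have "(\<lambda>n. cnj (x n * cnj (y n))) sums cnj (l2_inner x y)"
    by (simp only: sums_cnj)
  then show ?thesis
    unfolding l2_inner_def by (simp add: sums_iff mult.commute)
qed

lemma l2_norm_square: "x \<in> l2 \<Longrightarrow> (l2_norm x)\<^sup>2 = (\<Sum>n. (cmod (x n))\<^sup>2)"
  unfolding l2_norm_def by (rule real_sqrt_pow2) (auto simp: l2_def intro: suminf_nonneg)

lemma l2_inner_self:
  assumes "x \<in> l2"
  shows "l2_inner x x = of_real ((l2_norm x)\<^sup>2)"
  using assms unfolding l2_inner_def l2_norm_square[OF assms]
  by (simp add: l2_def suminf_of_real flip: complex_norm_square)

lemma cmod_le_l2_norm:
  assumes "x \<in> l2"
  shows "cmod (x k) \<le> l2_norm x"
proof -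
  have "(\<Sum>n\<in>{k}. (cmod (x n))\<^sup>2) \<le> (\<Sum>n. (cmod (x n))\<^sup>2)"
    using assms by (intro sum_le_suminf) (auto simp: l2_def)
  then show ?thesis
    unfolding l2_norm_def by (simp add: real_le_rsqrt)
qed

lemma l2_norm_eq_0: "x \<in> l2 \<Longrightarrow> l2_norm x = 0 \<Longrightarrow> x = 0"
  using cmod_le_l2_norm[of x] by (auto simp: fun_eq_iff)

lemma l2_Cauchy_Schwarz:
  assumes x: "x \<in> l2" and y: "y \<in> l2"
  shows "cmod (l2_inner x y) \<le> l2_norm x * l2_norm y"
proof -
  have L: "L2_set (\<lambda>n. cmod (z n)) {..<N} \<le> l2_norm z" if "z \<in> l2" for z N
    using that unfolding L2_set_def l2_norm_def
    by (intro real_sqrt_le_mono sum_le_suminf) (auto simp: l2_def)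
  have "(\<Sum>n<N. cmod (x n * cnj (y n))) \<le> l2_norm x * l2_norm y" for N
  proof -
    have "(\<Sum>n<N. cmod (x n * cnj (y n))) = (\<Sum>n<N. \<bar>cmod (x n)\<bar> * \<bar>cmod (y n)\<bar>)"
      by (simp add: norm_mult)
    also have "\<dots> \<le> L2_set (\<lambda>n. cmod (x n)) {..<N} * L2_set (\<lambda>n. cmod (y n)) {..<N}"
      by (rule L2_set_mult_ineq)
    also have "\<dots> \<le> l2_norm x * l2_norm y"
      using x y by (intro mult_mono L order_trans[OF L2_set_nonneg L]) (auto simp: L2_set_nonneg)
    finally show ?thesis .
  qed
  then have "(\<Sum>n. cmod (x n * cnj (y n))) \<le> l2_norm x * l2_norm y"
    using l2_summable_inner[OF x y] by (intro suminf_le_const)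
  then show ?thesis
    unfolding l2_inner_def using summable_norm[OF l2_summable_inner[OF x y]] by linarith
qed

section \<open>Scalar spectral measures\<close>

text \<open>Stated with two measures on each side because measures have no addition.\<close>
lemma nn_integral_add_measures_eq:
  assumes [measurable_cong]: "sets N1 = sets borel" "sets N2 = sets borel" "sets M1 = sets borel" "sets M2 = sets borel"
    and eq: "\<And>B. B \<in> sets borel \<Longrightarrow>
      emeasure N1 B + emeasure N2 B = emeasure M1 B + emeasure M2 B"
    and f: "f \<in> borel_measurable borel"
  shows "(\<integral>\<^sup>+ l. f l \<partial>N1) + (\<integral>\<^sup>+ l. f l \<partial>N2) = (\<integral>\<^sup>+ l. f l \<partial>M1) + (\<integral>\<^sup>+ l. f l \<partial>M2)"
  using f
proof (induction f)
  case (cong f g)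
  then show ?case by simp
next
  case (set A)
  then show ?case using eq[of A] assms(1-4) by simp
next
  case (mult u c)
  note [measurable] = mult(2)
  show ?case using mult by (simp add: nn_integral_cmult flip: distrib_left)
next
  case (add u v)
  note [measurable] = add(1,4)
  show ?case using add by (simp add: nn_integral_add ac_simps)
next
  case (seq U)
  note [measurable] = seq.hyps(1)
  have 1: "(\<integral>\<^sup>+ l. (SUP i. U i) l \<partial>N) = (SUP i. \<integral>\<^sup>+ l. U i l \<partial>N)"
    if [measurable_cong]: "sets N = sets borel" for N
    unfolding SUP_apply using seq.hyps(3) by (intro nn_integral_monotone_convergence_SUP) auto
  have inc: "incseq (\<lambda>i. \<integral>\<^sup>+ l. U i l \<partial>N)" for N
    using seq.hyps(3) by (auto simp: incseq_def le_fun_def intro!: nn_integral_mono)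
  show ?case
    unfolding 1[OF assms(1)] 1[OF assms(2)] 1[OF assms(3)] 1[OF assms(4)]
    using seq.IH by (simp add: ennreal_SUP_add[symmetric] inc)
qed

text \<open>The nonnegative case is applied to the positive and negative parts of f; integrability
  permits subtracting the results.\<close>

lemma integral_add_measures_eq:
  fixes f :: "real \<Rightarrow> real"
  assumes sets: "sets N1 = sets borel" "sets N2 = sets borel" "sets M1 = sets borel" "sets M2 = sets borel"
    and eq: "\<And>B. B \<in> sets borel \<Longrightarrow>
      emeasure N1 B + emeasure N2 B = emeasure M1 B + emeasure M2 B"
    and int: "integrable N1 f" "integrable N2 f" "integrable M1 f" "integrable M2 f"
  shows "(\<integral>l. f l \<partial>N1) + (\<integral>l. f l \<partial>N2) = (\<integral>l. f l \<partial>M1) + (\<integral>l. f l \<partial>M2)"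
proof -
  have f: "f \<in> borel_measurable borel"
    using int(1) sets(1) by (simp cong: measurable_cong_sets add: borel_measurable_integrable)
  have pos: "(\<integral>l. max 0 (g l) \<partial>N1) + (\<integral>l. max 0 (g l) \<partial>N2)
      = (\<integral>l. max 0 (g l) \<partial>M1) + (\<integral>l. max 0 (g l) \<partial>M2)"
    if g: "integrable N1 g" "integrable N2 g" "integrable M1 g" "integrable M2 g" 
       "g \<in> borel_measurable borel" for g :: "real \<Rightarrow> real"
  proof -
    have *: "(\<integral>\<^sup>+ l. ennreal (max 0 (g l)) \<partial>N) = ennreal (\<integral>l. max 0 (g l) \<partial>N)"
      if "integrable N g" for N
      using that by (intro nn_integral_eq_integral) auto
    have "(\<integral>\<^sup>+ l. ennreal (max 0 (g l)) \<partial>N1) + (\<integral>\<^sup>+ l. ennreal (max 0 (g l)) \<partial>N2)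
      = (\<integral>\<^sup>+ l. ennreal (max 0 (g l)) \<partial>M1) + (\<integral>\<^sup>+ l. ennreal (max 0 (g l)) \<partial>M2)"
      using g(5) by (intro nn_integral_add_measures_eq sets eq) auto
    then show ?thesis
      unfolding *[OF g(1)] *[OF g(2)] *[OF g(3)] *[OF g(4)]
      by (simp flip: ennreal_plus add: integral_nonneg_AE)
  qed
  have split: "(\<integral>l. f l \<partial>N) = (\<integral>l. max 0 (f l) \<partial>N) - (\<integral>l. max 0 (- f l) \<partial>N)"
    if "integrable N f" for N
  proof -
    have "(\<integral>l. f l \<partial>N) = (\<integral>l. max 0 (f l) - max 0 (- f l) \<partial>N)"
      by (intro Bochner_Integration.integral_cong) (auto simp: max_def)
    then show ?thesis using that by simp
  qed
  show ?thesis
    unfolding split[OF int(1)] split[OF int(2)] split[OF int(3)] split[OF int(4)]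
    using pos[of f] pos[of "\<lambda>l. - f l"] int f by simp
qed

section \<open>Calculus of projection-valued measures and their scalar measures\<close>

locale pvm =
  fixes E :: "real set \<Rightarrow> cseq \<Rightarrow> cseq"
  assumes pvm: "projection_valued_measure E"
begin

lemma E_l2 [intro, simp]: "B \<in> sets borel \<Longrightarrow> x \<in> l2 \<Longrightarrow> E B x \<in> l2"
  and E_add: "B \<in> sets borel \<Longrightarrow> x \<in> l2 \<Longrightarrow> y \<in> l2 \<Longrightarrow> E B (x + y) = E B x + E B y"
  and E_scale: "B \<in> sets borel \<Longrightarrow> x \<in> l2 \<Longrightarrow> E B (cscale c x) = cscale c (E B x)"
  and E_adjoint: "B \<in> sets borel \<Longrightarrow> x \<in> l2 \<Longrightarrow> y \<in> l2 \<Longrightarrow> l2_inner (E B x) y = l2_inner x (E B y)"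
  and E_idem: "B \<in> sets borel \<Longrightarrow> x \<in> l2 \<Longrightarrow> E B (E B x) = E B x"
  and E_UNIV: "x \<in> l2 \<Longrightarrow> E UNIV x = x"
  and E_Int: "B \<in> sets borel \<Longrightarrow> C \<in> sets borel \<Longrightarrow> x \<in> l2 \<Longrightarrow> E B (E C x) = E (B \<inter> C) x"
  using pvm unfolding projection_valued_measure_def orthogonal_projection_def by auto

lemma E_diff: "B \<in> sets borel \<Longrightarrow> x \<in> l2 \<Longrightarrow> y \<in> l2 \<Longrightarrow> E B (x - y) = E B x - E B y"
  unfolding cseq_diff_eq by (simp only: E_add E_scale l2_scale)

lemma E_sum_tendsto:
  assumes "range F \<subseteq> sets borel" "disjoint_family F" "x \<in> l2"
  shows "(\<lambda>N. l2_norm ((\<Sum>i<N. E (F i) x) - E (\<Union>i. F i) x)) \<longlonglongrightarrow> 0"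
  using assms pvm unfolding projection_valued_measure_def by blast

abbreviation \<mu> where "\<mu> \<equiv> pvm_measure E"

text \<open>A real-valued stand-in for the scalar measure: \<open>measure_of\<close> returns the
  prescribed values only once countable additivity is known, and \<open>emeasure_mu\<close> then
  identifies the two.\<close>

definition wt :: "cseq \<Rightarrow> real set \<Rightarrow> real" where
  "wt x B = Re (l2_inner (E B x) x)"

lemma wt_eq_inner:
  assumes "B \<in> sets borel" "x \<in> l2"
  shows "l2_inner (E B x) x = of_real (wt x B)" "wt x B = (l2_norm (E B x))\<^sup>2"
proof -
  have "l2_inner (E B x) x = of_real ((l2_norm (E B x))\<^sup>2)"
    using assms E_adjoint[of B "E B x" x] by (simp add: E_idem l2_inner_self)
  then show "l2_inner (E B x) x = of_real (wt x B)" "wt x B = (l2_norm (E B x))\<^sup>2"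
    by (simp_all add: wt_def)
qed

lemma wt_nonneg: "B \<in> sets borel \<Longrightarrow> x \<in> l2 \<Longrightarrow> wt x B \<ge> 0"
  by (simp add: wt_eq_inner)

lemma E_sum_l2:
  assumes "range F \<subseteq> sets borel" "x \<in> l2"
  shows "(\<Sum>i<N::nat. E (F i) x) \<in> l2 \<and> l2_inner (\<Sum>i<N. E (F i) x) x = of_real (\<Sum>i<N. wt x (F i))"
proof (induction N)
  case 0
  then show ?case by (simp add: l2_def l2_inner_def)
next
  case (Suc N)
  have "E (F N) x \<in> l2" using assms by auto
  moreover have "l2_inner (E (F N) x) x = of_real (wt x (F N))"
    using assms by (intro wt_eq_inner) auto
  ultimately show ?case
    using Suc assms(2) unfolding sum.lessThan_Suc by (simp only: l2_add l2_inner_add_left of_real_add simp_thms)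
qed

text \<open>Norm convergence of the sums of the E (F i) x passes to the scalar values by
  Cauchy-Schwarz.\<close>

lemma wt_sums:
  assumes F: "range F \<subseteq> sets borel" "disjoint_family F" and x: "x \<in> l2"
  shows "(\<lambda>i. wt x (F i)) sums wt x (\<Union>i. F i)"
proof -
  have U: "(\<Union>i. F i) \<in> sets borel" using F by auto
  define d where "d N = (\<Sum>i<N. E (F i) x) - E (\<Union>i. F i) x" for N
  have d: "d N \<in> l2" for N
    unfolding d_def using E_sum_l2[OF F(1) x] U x by (intro l2_diff) auto
  have "Re (l2_inner (d N) x) = (\<Sum>i<N. wt x (F i)) - wt x (\<Union>i. F i)" for N
    unfolding d_def using E_sum_l2[OF F(1) x] U x wt_eq_inner(1)[OF U x]
    by (simp add: l2_inner_diff_left)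
  then have "\<bar>(\<Sum>i<N. wt x (F i)) - wt x (\<Union>i. F i)\<bar> \<le> l2_norm (d N) * l2_norm x" for N
    using abs_Re_le_cmod[of "l2_inner (d N) x"] l2_Cauchy_Schwarz[OF d x, of N] by simp
  moreover have "(\<lambda>N. l2_norm (d N) * l2_norm x) \<longlonglongrightarrow> 0"
    unfolding d_def using tendsto_mult_left_zero[OF E_sum_tendsto[OF F x]] .
  ultimately have "(\<lambda>N. (\<Sum>i<N. wt x (F i)) - wt x (\<Union>i. F i)) \<longlonglongrightarrow> 0"
    using Lim_null_comparison[of "\<lambda>N. (\<Sum>i<N. wt x (F i)) - wt x (\<Union>i. F i)" "\<lambda>N. l2_norm (d N) * l2_norm x"]
    by simp
  then show ?thesis unfolding sums_def by (simp add: LIM_zero_iff)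
qed

text \<open>A constant series can converge only if its terms vanish, so countable additivity for the
  empty family forces the value 0.\<close>

lemma wt_empty: "x \<in> l2 \<Longrightarrow> wt x {} = 0"
proof -
  assume "x \<in> l2"
  then have "(\<lambda>i::nat. wt x {}) sums wt x (\<Union>i::nat. {})"
    by (intro wt_sums) (auto simp: disjoint_family_on_def)
  then have "(\<lambda>i::nat. wt x {}) \<longlonglongrightarrow> 0"
    by (intro summable_LIMSEQ_zero) (auto simp: summable_def)
  then show ?thesis by (simp add: LIMSEQ_const_iff)
qed

lemma E_empty: "x \<in> l2 \<Longrightarrow> E {} x = 0"
  using wt_eq_inner(2)[of "{}" x] wt_empty[of x] by (intro l2_norm_eq_0) auto

lemma sets_mu [simp, measurable_cong]: "sets (\<mu> x) = sets borel"
  unfolding pvm_measure_def using sets.sigma_sets_eq[of borel] by simp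

lemma space_mu [simp]: "space (\<mu> x) = UNIV"
  by (simp add: pvm_measure_def space_measure_of_conv)

lemma emeasure_mu:
  assumes "B \<in> sets borel" "x \<in> l2"
  shows "emeasure (\<mu> x) B = ennreal (wt x B)"
proof (rule emeasure_measure_of[OF pvm_measure_def[of E x], folded wt_def])
  show "positive (sets (\<mu> x)) (\<lambda>B. ennreal (wt x B))"
    using assms by (simp add: positive_def wt_empty)
  show "countably_additive (sets (\<mu> x)) (\<lambda>B. ennreal (wt x B))"
    unfolding countably_additive_def
  proof (intro allI impI)
    fix F :: "nat \<Rightarrow> real set"
    assume F: "range F \<subseteq> sets (\<mu> x)" "disjoint_family F"
    show "(\<Sum>i. ennreal (wt x (F i))) = ennreal (wt x (\<Union>i. F i))"
      using F assms by (intro suminf_ennreal_eq wt_sums wt_nonneg) auto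
  qed
qed (use assms in auto)

lemma finite_mu [simp]: "x \<in> l2 \<Longrightarrow> finite_measure (\<mu> x)"
  by (rule finite_measureI) (simp add: emeasure_mu)

lemma E_compl:
  assumes C: "C \<in> sets borel" and x: "x \<in> l2"
  shows "E C x + E (- C) x = x"
proof -
  define F :: "nat \<Rightarrow> real set" where "F = binaryset C (- C)"
  have [simp]: "F 0 = C" "F (Suc 0) = - C" "F (Suc (Suc n)) = {}" for n
    by (simp_all add: F_def binaryset_def)
  have "range F \<subseteq> sets borel" "(\<Union>i. F i) = UNIV"
    using C by (auto simp: F_def range_binaryset_eq UN_binaryset_eq)
  moreover have "disjoint_family F"
    by (auto simp: disjoint_family_on_def F_def binaryset_def)
  ultimately have "(\<lambda>N. l2_norm ((\<Sum>i<N. E (F i) x) - x)) \<longlonglongrightarrow> 0"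
    using E_sum_tendsto[of F x] x by (simp add: E_UNIV)
  \<comment> \<open>After the first two sets all are empty, so the shifted partial sums are constant
    and the limit becomes an equality.\<close>
  then have "(\<lambda>N. l2_norm ((\<Sum>i<N + 2. E (F i) x) - x)) \<longlonglongrightarrow> 0"
    by (rule LIMSEQ_ignore_initial_segment)
  moreover have "(\<Sum>i<N + 2. E (F i) x) = E C x + E (- C) x" for N
    by (induction N) (use x in \<open>simp_all add: E_empty numeral_2_eq_2\<close>)
  ultimately have "l2_norm (E C x + E (- C) x - x) = 0"
    by (simp add: LIMSEQ_const_iff)
  then have "E C x + E (- C) x - x = 0"
    using C x by (intro l2_norm_eq_0 l2_diff l2_add E_l2) auto
  then show ?thesis by simp
qed

lemma mu_E:
  assumes "C \<in> sets borel" "x \<in> l2"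
  shows "\<mu> (E C x) = density (\<mu> x) (\<lambda>l. ennreal (indicator C l))"
proof (rule measure_eqI)
  fix B assume "B \<in> sets (\<mu> (E C x))"
  then have B: "B \<in> sets borel" by simp
  have "emeasure (\<mu> (E C x)) B = emeasure (\<mu> x) (C \<inter> B)"
    using assms B by (simp add: emeasure_mu wt_eq_inner E_Int E_idem Int_commute)
  also have "\<dots> = emeasure (density (\<mu> x) (\<lambda>l. ennreal (indicator C l))) B"
    using assms B by (simp add: emeasure_density ennreal_indicator flip: indicator_inter_arith)
  finally show "emeasure (\<mu> (E C x)) B = emeasure (density (\<mu> x) (\<lambda>l. ennreal (indicator C l))) B" .
qed simp

text \<open>By \<open>spectral_pvm\<close> this is the domain of the operator. Described through E
  alone, it can be shown to be a subspace invariant under every E C without reference to the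
  operator.\<close>

definition D :: "cseq set" where
  "D = {x \<in> l2. integrable (\<mu> x) (\<lambda>l. l\<^sup>2)}"

lemma D_l2: "x \<in> D \<Longrightarrow> x \<in> l2"
  by (simp add: D_def)

lemma D_iff: "x \<in> D \<longleftrightarrow> x \<in> l2 \<and> (\<integral>\<^sup>+ l. ennreal (l\<^sup>2) \<partial>\<mu> x) < \<infinity>"
  by (simp add: D_def integrable_iff_bounded)

lemma wt_polarize:
  assumes "B \<in> sets borel" "x \<in> l2" "y \<in> l2"
  shows "wt (x + y) B = wt x B + wt y B + 2 * Re (l2_inner (E B x) y)"
    and "wt (x - y) B = wt x B + wt y B - 2 * Re (l2_inner (E B x) y)"
proof -
  have "l2_inner (E B y) x = cnj (l2_inner (E B x) y)"
    using assms by (simp add: E_adjoint[of B y x] l2_inner_commute[of "E B x" y])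
  then have "Re (l2_inner (E B y) x) = Re (l2_inner (E B x) y)"
    by simp
  then show "wt (x + y) B = wt x B + wt y B + 2 * Re (l2_inner (E B x) y)"
      "wt (x - y) B = wt x B + wt y B - 2 * Re (l2_inner (E B x) y)"
    using assms by (simp_all add: wt_def E_add E_diff l2_inner_simps l2_add l2_diff)
qed

lemma D_E:
  assumes "C \<in> sets borel" "x \<in> D"
  shows "E C x \<in> D"
proof -
  have "(\<integral>\<^sup>+ l. ennreal (l\<^sup>2) \<partial>\<mu> (E C x)) = (\<integral>\<^sup>+ l. ennreal (indicator C l) * ennreal (l\<^sup>2) \<partial>\<mu> x)"
    using assms D_l2 by (simp add: mu_E nn_integral_density)
  also have "\<dots> \<le> (\<integral>\<^sup>+ l. ennreal (l\<^sup>2) \<partial>\<mu> x)"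
    by (intro nn_integral_mono) (auto simp: indicator_def)
  finally show ?thesis
    using assms by (auto simp: D_iff)
qed

lemma D_scale:
  assumes "x \<in> D"
  shows "cscale c x \<in> D"
proof -
  have x: "x \<in> l2" using assms D_l2 by simp
  have "\<mu> (cscale c x) = density (\<mu> x) (\<lambda>_. ennreal ((cmod c)\<^sup>2))"
  proof (rule measure_eqI)
    fix B assume "B \<in> sets (\<mu> (cscale c x))"
    then have B: "B \<in> sets borel" by simp
    have "wt (cscale c x) B = (cmod c)\<^sup>2 * wt x B"
    proof -
      have "l2_inner (E B (cscale c x)) (cscale c x) = of_real ((cmod c)\<^sup>2 * wt x B)"
        using B x by (simp add: E_scale l2_inner_simps l2_scale wt_eq_inner)
          (simp add: complex_norm_square[symmetric] algebra_simps)
      then show ?thesis by (simp add: wt_def)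
    qed
    then show "emeasure (\<mu> (cscale c x)) B = emeasure (density (\<mu> x) (\<lambda>_. ennreal ((cmod c)\<^sup>2))) B"
      using B x by (simp add: emeasure_mu l2_scale emeasure_density_const ennreal_mult wt_nonneg)
  qed simp
  then have "(\<integral>\<^sup>+ l. ennreal (l\<^sup>2) \<partial>\<mu> (cscale c x)) = ennreal ((cmod c)\<^sup>2) * (\<integral>\<^sup>+ l. ennreal (l\<^sup>2) \<partial>\<mu> x)"
    by (simp add: nn_integral_density nn_integral_cmult)
  then show ?thesis
    using assms by (simp add: D_iff l2_scale ennreal_mult_less_top)
qed

lemma D_add:
  assumes "x \<in> D" "y \<in> D"
  shows "x + y \<in> D"
proof -
  have l2: "x \<in> l2" "y \<in> l2" using assms D_l2 by auto
  have s: "sqrt 2 * sqrt 2 = (2::real)" by simp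
  have wt2: "wt (cscale (sqrt 2) z) B = 2 * wt z B" if "z \<in> l2" "B \<in> sets borel" for z B
    using that s by (simp add: wt_def E_scale l2_inner_simps l2_scale flip: mult.assoc of_real_mult)
  \<comment> \<open>The parallelogram law for the scalar measures. Its factor 2 is absorbed into the
    vectors as sqrt 2, so that each side is a sum of two such measures.\<close>
  have "(\<integral>\<^sup>+ l. ennreal (l\<^sup>2) \<partial>\<mu> (x + y)) + (\<integral>\<^sup>+ l. ennreal (l\<^sup>2) \<partial>\<mu> (x - y))
    = (\<integral>\<^sup>+ l. ennreal (l\<^sup>2) \<partial>\<mu> (cscale (sqrt 2) x)) + (\<integral>\<^sup>+ l. ennreal (l\<^sup>2) \<partial>\<mu> (cscale (sqrt 2) y))"
  proof (intro nn_integral_add_measures_eq)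
    fix B :: "real set" assume B: "B \<in> sets borel"
    then have "wt (x + y) B + wt (x - y) B = wt (cscale (sqrt 2) x) B + wt (cscale (sqrt 2) y) B"
      using l2 by (simp add: wt_polarize wt2)
    then show "emeasure (\<mu> (x + y)) B + emeasure (\<mu> (x - y)) B
       = emeasure (\<mu> (cscale (sqrt 2) x)) B + emeasure (\<mu> (cscale (sqrt 2) y)) B"
      using l2 B by (simp add: emeasure_mu l2_add l2_diff l2_scale wt_nonneg del: ennreal_plus flip: ennreal_plus)
  qed auto
  also have "\<dots> < \<infinity>"
    using D_scale[of x "sqrt 2"] D_scale[of y "sqrt 2"] assms by (simp add: D_iff)
  finally have "(\<integral>\<^sup>+ l. ennreal (l\<^sup>2) \<partial>\<mu> (x + y)) < \<infinity>"
    by (simp add: ennreal_add_less_top) 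
  then show ?thesis using l2 by (simp add: D_iff l2_add)
qed

lemma D_diff: "x \<in> D \<Longrightarrow> y \<in> D \<Longrightarrow> x - y \<in> D"
  unfolding cseq_diff_eq by (intro D_add D_scale)

lemma D_integrable:
  assumes "x \<in> D"
  shows "integrable (\<mu> x) (\<lambda>l. l\<^sup>2)" "integrable (\<mu> x) (\<lambda>l. l)"
proof -
  interpret finite_measure "\<mu> x" using assms D_l2 by simp
  show 2: "integrable (\<mu> x) (\<lambda>l. l\<^sup>2)" using assms by (simp add: D_def)
  have "norm l \<le> norm (1 + l\<^sup>2)" for l :: real
  proof -
    have "0 \<le> (\<bar>l\<bar> - 1)\<^sup>2" by simp
    then have "2 * \<bar>l\<bar> \<le> 1 + l\<^sup>2" by (simp add: power2_diff)
    then show ?thesis by simp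
  qed
  moreover have 3: "integrable (\<mu> x) (\<lambda>l. 1 + l\<^sup>2)" using 2 by simp
  ultimately show "integrable (\<mu> x) (\<lambda>l. l)"
    by (intro Bochner_Integration.integrable_bound[OF 3]) auto
qed

lemma integral_E:
  fixes f :: "real \<Rightarrow> real"
  assumes "C \<in> sets borel" "x \<in> l2" "f \<in> borel_measurable borel"
  shows "(\<integral>l. f l \<partial>\<mu> (E C x)) = (\<integral>l. indicator C l * f l \<partial>\<mu> x)"
  using integral_density[of f "\<mu> x" "indicator C"] assms by (simp add: mu_E)

end

section \<open>Moments of the scalar spectral measures\<close>

text \<open>\<open>J\<close> is linear on all sequences but controlled only on \<open>D\<close>, and
  only through its quadratic form. Its interaction with E has to be recovered by
  polarization.\<close>

locale spectral_operator = pvm +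
  fixes J :: "cseq \<Rightarrow> cseq"
  assumes J_l2: "x \<in> D \<Longrightarrow> J x \<in> l2"
    and J_add: "J (x + y) = J x + J y"
    and J_scale: "J (cscale c x) = cscale c (J x)"
    and quadratic_form: "x \<in> D \<Longrightarrow> l2_inner (J x) x = of_real (\<integral>l. l \<partial>\<mu> x)"
begin

lemma J_diff: "J (x - y) = J x - J y"
  unfolding cseq_diff_eq by (simp only: J_add J_scale)

text \<open>A quadratic form with real values has a Hermitian polar form; testing x + y and x + i y
  gives the imaginary and real parts of this.\<close>

lemma J_symmetric:
  assumes x: "x \<in> D" and y: "y \<in> D"
  shows "l2_inner (J x) y = l2_inner x (J y)"
proof -
  have real: "Im (l2_inner (J z) z) = 0" if "z \<in> D" for z
    using quadratic_form[OF that] by simp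
  note l2 = D_l2[OF x] D_l2[OF y] J_l2[OF x] J_l2[OF y]
  have "Im (l2_inner (J x) y) + Im (l2_inner (J y) x) = 0"
    using real[OF D_add[OF x y]] real[OF x] real[OF y] l2
    by (simp add: J_add l2_inner_simps l2_add)
  moreover have "Re (l2_inner (J y) x) - Re (l2_inner (J x) y) = 0"
    using real[OF D_add[OF x D_scale[OF y, of \<i>]]] real[OF x] real[OF y] l2
    by (simp add: J_add J_scale l2_inner_simps l2_add l2_scale)
  ultimately have "l2_inner (J y) x = cnj (l2_inner (J x) y)"
    by (simp add: complex_eq_iff)
  then show ?thesis using l2 l2_inner_commute[of "J y" x] by simp
qed

text \<open>The integral of lambda splits over C and its complement, so the form at z is the sum of
  the forms at E C z and E (- C) z. The cross terms, conjugate to each other by symmetry, must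
  therefore have real part 0.\<close>

lemma J_cross:
  assumes C: "C \<in> sets borel" and x: "x \<in> D" and y: "y \<in> D"
  shows "l2_inner (J (E C x)) (E (- C) y) = 0"
proof -
  have C': "- C \<in> sets borel" using C by auto
  note l2 = D_l2[OF x] D_l2[OF y]
  have re: "Re (l2_inner (J (E C z)) (E (- C) z)) = 0" if z: "z \<in> D" for z
  proof -
    note D1 = D_E[OF C z] D_E[OF C' z]
    have "(\<integral>l. l \<partial>\<mu> z) = (\<integral>l. indicator C l * l + indicator (- C) l * l \<partial>\<mu> z)"
      by (intro Bochner_Integration.integral_cong) (auto simp: indicator_def)
    also have "\<dots> = (\<integral>l. indicator C l * l \<partial>\<mu> z) + (\<integral>l. indicator (- C) l * l \<partial>\<mu> z)"
      using C C' D_integrable[OF z] 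
      by (intro Bochner_Integration.integral_add integrable_real_mult_indicator[unfolded mult.commute[of _ "indicator _ _"]]) auto
    finally have "l2_inner (J z) z = l2_inner (J (E C z)) (E C z) + l2_inner (J (E (- C) z)) (E (- C) z)"
      using z D1 C C' D_l2[OF z] by (simp add: quadratic_form integral_E)
    moreover have "l2_inner (J z) z = l2_inner (J (E C z + E (- C) z)) (E C z + E (- C) z)"
      using E_compl[OF C] D_l2[OF z] by simp
    moreover have "l2_inner (J (E C z + E (- C) z)) (E C z + E (- C) z)
        = l2_inner (J (E C z)) (E C z) + l2_inner (J (E (- C) z)) (E (- C) z)
        + (l2_inner (J (E C z)) (E (- C) z) + l2_inner (J (E (- C) z)) (E C z))"
      using D1 by (simp add: J_add l2_inner_simps l2_add D_l2 J_l2)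
    ultimately have "l2_inner (J (E C z)) (E (- C) z) + l2_inner (J (E (- C) z)) (E C z) = 0"
      by simp
    moreover have "l2_inner (J (E (- C) z)) (E C z) = cnj (l2_inner (J (E C z)) (E (- C) z))"
      using J_symmetric[OF D1(2,1)] D1 by (simp add: l2_inner_commute[symmetric] D_l2 J_l2)
    ultimately show ?thesis by (simp add: complex_eq_iff)
  qed
  \<comment> \<open>The vector z joins the C-part of x to c times the complementary part of y; the
    phases c = 1 and c = i then cover real and imaginary parts.\<close>
  have *: "Re (cnj c * l2_inner (J (E C x)) (E (- C) y)) = 0" for c
  proof -
    define z where "z = E C x + cscale c (E (- C) y)"
    have z: "z \<in> D" unfolding z_def using C C' x y by (intro D_add D_scale D_E)
    have "E C z = E C x" "E (- C) z = cscale c (E (- C) y)"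
      using C C' l2 by (simp_all add: z_def E_add E_scale E_idem E_Int E_empty l2_scale)
    then show ?thesis
      using re[OF z] D_E[OF C x] D_E[OF C' y] by (simp add: l2_inner_simps D_l2 J_l2)
  qed
  show ?thesis using *[of 1] *[of \<i>] by (simp add: complex_eq_iff)
qed

text \<open>A weak form of commutation of E C with J: moving E C onto y and splitting x, the part of
  x outside C drops out by \<open>J_cross\<close>.\<close>

lemma E_J:
  assumes C: "C \<in> sets borel" and x: "x \<in> D" and y: "y \<in> D"
  shows "l2_inner (E C (J x)) y = l2_inner (J (E C x)) (E C y)"
proof -
  have C': "- C \<in> sets borel" using C by auto
  have "l2_inner (E C (J x)) y = l2_inner (J (E C x + E (- C) x)) (E C y)"
    using C x y by (simp add: E_adjoint J_l2 D_l2 E_compl)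
  also have "\<dots> = l2_inner (J (E C x)) (E C y)"
    using J_cross[OF C' x y] D_E[OF C x] D_E[OF C' x] D_E[OF C y]
    by (simp add: J_add l2_inner_simps D_l2 J_l2)
  finally show ?thesis .
qed

lemma inner_E_J:
  assumes C: "C \<in> sets borel" and x: "x \<in> D"
  shows "l2_inner (J (E C x)) (E C x) = of_real (\<integral>l. indicator C l * l \<partial>\<mu> x)"
  using quadratic_form[OF D_E[OF C x]] C x by (simp add: integral_E D_l2)

text \<open>Polarization expresses both \<open>d[E x, J x] = \<lambda> d[E x, x]\<close> and \<open>d[E J x, J x]\<close> through the
  measures of \<open>x + J x\<close> and \<open>x - J x\<close>; integrating \<open>\<lambda>\<close> against the former yields the latter.\<close>
lemma mu_J:
  assumes x: "x \<in> D" and v: "J x \<in> D"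
  shows "\<mu> (J x) = density (\<mu> x) (\<lambda>l. ennreal (l\<^sup>2))"
proof (rule measure_eqI)
  note l2 = D_l2[OF x] D_l2[OF v]
  note int = D_integrable[OF x]
  let ?v = "J x"
  fix C assume "C \<in> sets (\<mu> ?v)"
  then have C: "C \<in> sets borel" by simp
  have ind: "integrable M (\<lambda>l. indicator C l * f l)" if "integrable M f" "sets M = sets borel" for M and f :: "real \<Rightarrow> real"
    using integrable_real_mult_indicator[of C M f] that C by (simp add: mult.commute)
  \<comment> \<open>N and P are the negative and positive parts of 4 lambda d[E x, x], with 4 coming
    from polarization over x + J x and x - J x. Placing them on opposite sides keeps the identity
    among nonnegative measures.\<close>
  define N where "N = density (\<mu> x) (\<lambda>l. ennreal (4 * max 0 (- l)))"
  define P where "P = density (\<mu> x) (\<lambda>l. ennreal (4 * max 0 l))"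
  have eq: "emeasure (\<mu> (x + ?v)) B + emeasure N B = emeasure (\<mu> (x - ?v)) B + emeasure P B"
    if B: "B \<in> sets borel" for B
  proof -
    have ind: "integrable (\<mu> x) (\<lambda>l. indicator B l * f l)" if "integrable (\<mu> x) f" for f :: "real \<Rightarrow> real"
      using integrable_real_mult_indicator[of B "\<mu> x" f] that B by (simp add: mult.commute)
    have den: "emeasure (density (\<mu> x) (\<lambda>l. ennreal (g l))) B = ennreal (\<integral>l. indicator B l * g l \<partial>\<mu> x)"
      if g: "integrable (\<mu> x) g" "\<And>l. g l \<ge> 0" for g
    proof -
      have "emeasure (density (\<mu> x) (\<lambda>l. ennreal (g l))) B = (\<integral>\<^sup>+ l. ennreal (indicator B l * g l) \<partial>\<mu> x)"
        using g(1) B by (subst emeasure_density)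
          (auto intro!: nn_integral_cong simp: indicator_def borel_measurable_integrable)
      also have "\<dots> = ennreal (\<integral>l. indicator B l * g l \<partial>\<mu> x)"
        using g ind[OF g(1)] by (intro nn_integral_eq_integral) auto
      finally show ?thesis .
    qed
    have "Re (l2_inner (E B x) ?v) = (\<integral>l. indicator B l * l \<partial>\<mu> x)"
    proof -
      have "l2_inner (E B x) ?v = cnj (l2_inner (E B ?v) x)"
        using B l2 by (simp add: E_adjoint[of B x] l2_inner_commute[of "E B (J x)" x])
      then show ?thesis using E_J[OF B x x] inner_E_J[OF B x] by simp
    qed
    moreover have "(\<integral>l. indicator B l * (4 * max 0 l) \<partial>\<mu> x) - (\<integral>l. indicator B l * (4 * max 0 (- l)) \<partial>\<mu> x)
      = (\<integral>l. 4 * (indicator B l * l) \<partial>\<mu> x)"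
    proof -
      have "integrable (\<mu> x) (\<lambda>l. indicator B l * (4 * max 0 l))"
        "integrable (\<mu> x) (\<lambda>l. indicator B l * (4 * max 0 (- l)))"
        using int by (intro ind; simp)+
      from Bochner_Integration.integral_diff[OF this, symmetric] show ?thesis
        by (rule trans, intro Bochner_Integration.integral_cong refl) (simp add: max_def indicator_def)
    qed
    ultimately have "wt (x + ?v) B + (\<integral>l. indicator B l * (4 * max 0 (- l)) \<partial>\<mu> x)
        = wt (x - ?v) B + (\<integral>l. indicator B l * (4 * max 0 l) \<partial>\<mu> x)"
      using wt_polarize[OF B l2] by simp
    moreover have "(\<integral>l. indicator B l * (4 * max 0 l) \<partial>\<mu> x) \<ge> 0" "(\<integral>l. indicator B l * (4 * max 0 (- l)) \<partial>\<mu> x) \<ge> 0"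
      by (auto intro!: integral_nonneg_AE)
    ultimately show ?thesis
      unfolding N_def P_def using int B l2
      by (simp add: den emeasure_mu l2_add l2_diff wt_nonneg flip: ennreal_plus)
  qed
  have dint: "integrable (density (\<mu> x) (\<lambda>l. ennreal (g l))) (\<lambda>l. indicator C l * l)"
      "(\<integral>l. indicator C l * l \<partial>density (\<mu> x) (\<lambda>l. ennreal (g l))) = (\<integral>l. indicator C l * (g l * l) \<partial>\<mu> x)"
    if g: "integrable (\<mu> x) (\<lambda>l. g l * l)" "\<And>l. g l \<ge> 0" "g \<in> borel_measurable borel" for g
  proof -
    have m: "(\<lambda>l. indicator C l * l :: real) \<in> borel_measurable (\<mu> x)" "g \<in> borel_measurable (\<mu> x)"
      using C g(3) by auto
    have eqf: "(\<lambda>l. g l * (indicator C l * l)) = (\<lambda>l. indicator C l * (g l * l))"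
      by (simp add: fun_eq_iff)
    show "integrable (density (\<mu> x) (\<lambda>l. ennreal (g l))) (\<lambda>l. indicator C l * l)"
      using integrable_density[OF m] g(2) ind[OF g(1)] by (simp add: eqf)
    show "(\<integral>l. indicator C l * l \<partial>density (\<mu> x) (\<lambda>l. ennreal (g l))) = (\<integral>l. indicator C l * (g l * l) \<partial>\<mu> x)"
      using integral_density[OF m] g(2) by (simp add: eqf)
  qed
  \<comment> \<open>A second factor lambda appears when lambda is integrated against N and P; the
    finite second moment of x dominates it.\<close>
  have i4: "integrable (\<mu> x) (\<lambda>l. 4 * l\<^sup>2)" using int by simp
  have "norm (4 * max 0 l * l) \<le> norm (4 * l\<^sup>2)" "norm (4 * max 0 (- l) * l) \<le> norm (4 * l\<^sup>2)" for l :: real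
    by (simp_all add: max_def power2_eq_square abs_mult)
  then have gi: "integrable (\<mu> x) (\<lambda>l. 4 * max 0 l * l)" "integrable (\<mu> x) (\<lambda>l. 4 * max 0 (- l) * l)"
    by (intro Bochner_Integration.integrable_bound[OF i4] AE_I2; simp)+
  have iN: "integrable N (\<lambda>l. indicator C l * l)"
    unfolding N_def by (rule dint(1)) (use gi in auto)
  have iP: "integrable P (\<lambda>l. indicator C l * l)"
    unfolding P_def by (rule dint(1)) (use gi in auto)
  have "integrable (\<mu> (x + ?v)) (\<lambda>l. indicator C l * l)" "integrable (\<mu> (x - ?v)) (\<lambda>l. indicator C l * l)"
    by (intro ind D_integrable D_add D_diff x v sets_mu)+
  then have "(\<integral>l. indicator C l * l \<partial>\<mu> (x + ?v)) + (\<integral>l. indicator C l * l \<partial>N)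
      = (\<integral>l. indicator C l * l \<partial>\<mu> (x - ?v)) + (\<integral>l. indicator C l * l \<partial>P)"
    by (intro integral_add_measures_eq eq iN iP) (simp_all add: N_def P_def)
  also have "(\<integral>l. indicator C l * l \<partial>N) = (\<integral>l. indicator C l * (4 * max 0 (- l) * l) \<partial>\<mu> x)"
    unfolding N_def by (rule dint) (use gi in auto)
  also have "(\<integral>l. indicator C l * l \<partial>P) = (\<integral>l. indicator C l * (4 * max 0 l * l) \<partial>\<mu> x)"
    unfolding P_def by (rule dint) (use gi in auto)
  finally have "(\<integral>l. indicator C l * l \<partial>\<mu> (x + ?v)) - (\<integral>l. indicator C l * l \<partial>\<mu> (x - ?v))
      = (\<integral>l. indicator C l * (4 * max 0 l * l) \<partial>\<mu> x) - (\<integral>l. indicator C l * (4 * max 0 (- l) * l) \<partial>\<mu> x)"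
    by linarith
  also have "\<dots> = (\<integral>l. 4 * (indicator C l * l\<^sup>2) \<partial>\<mu> x)"
  proof -
    have "integrable (\<mu> x) (\<lambda>l. indicator C l * (4 * max 0 l * l))"
      "integrable (\<mu> x) (\<lambda>l. indicator C l * (4 * max 0 (- l) * l))"
      by (intro ind gi; simp)+
    from Bochner_Integration.integral_diff[OF this, symmetric] show ?thesis
      by (rule trans, intro Bochner_Integration.integral_cong refl)
        (simp add: max_def indicator_def power2_eq_square)
  qed
  finally have 1: "(\<integral>l. indicator C l * l \<partial>\<mu> (x + ?v)) - (\<integral>l. indicator C l * l \<partial>\<mu> (x - ?v))
      = 4 * (\<integral>l. indicator C l * l\<^sup>2 \<partial>\<mu> x)"
    by simp
  note D2 = D_E[OF C x] D_E[OF C v]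
  define A where "A = l2_inner (J (E C x)) (E C ?v)"
  have A: "A = of_real (wt ?v C)"
    unfolding A_def using E_J[OF C x v] wt_eq_inner[OF C l2(2)] by simp
  have A': "l2_inner (J (E C ?v)) (E C x) = of_real (wt ?v C)"
  proof -
    have "l2_inner (J (E C ?v)) (E C x) = l2_inner (E C ?v) (J (E C x))"
      by (rule J_symmetric[OF D2(2,1)])
    also have "\<dots> = cnj A"
      unfolding A_def using D2 by (intro l2_inner_commute J_l2 D_l2)
    finally show ?thesis by (simp add: A)
  qed
  \<comment> \<open>The diagonal terms cancel and each of the two cross terms occurs twice, with
    common value \<open>wt ?v C\<close>.\<close>
  have "l2_inner (J (E C (x + ?v))) (E C (x + ?v)) - l2_inner (J (E C (x - ?v))) (E C (x - ?v))
     = of_real (4 * wt ?v C)"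
    using l2 C D2 A A'
    by (simp add: A_def E_add E_diff J_add J_diff l2_inner_simps l2_add l2_diff D_l2 J_l2)
  then have "complex_of_real ((\<integral>l. indicator C l * l \<partial>\<mu> (x + ?v)) - (\<integral>l. indicator C l * l \<partial>\<mu> (x - ?v)))
      = of_real (4 * wt ?v C)"
    by (simp only: inner_E_J[OF C D_add[OF x v]] inner_E_J[OF C D_diff[OF x v]] of_real_diff)
  then have "wt ?v C = (\<integral>l. indicator C l * l\<^sup>2 \<partial>\<mu> x)"
    using 1 by (simp only: of_real_eq_iff)
  then have "emeasure (\<mu> ?v) C = ennreal (\<integral>l. indicator C l * l\<^sup>2 \<partial>\<mu> x)"
    using C l2 by (simp add: emeasure_mu)
  also have "\<dots> = (\<integral>\<^sup>+ l. ennreal (indicator C l * l\<^sup>2) \<partial>\<mu> x)"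
    using ind[OF int(1)] by (intro nn_integral_eq_integral[symmetric]) auto
  also have "\<dots> = emeasure (density (\<mu> x) (\<lambda>l. ennreal (l\<^sup>2))) C"
    using C by (subst emeasure_density) (auto intro!: nn_integral_cong simp: indicator_def)
  finally show "emeasure (\<mu> ?v) C = emeasure (density (\<mu> x) (\<lambda>l. ennreal (l\<^sup>2))) C" .
qed simp

text \<open>Iterating \<open>mu_J\<close> makes the even moments total masses of the measures of the
  iterates. Odd powers are dominated by 1 plus an even power, and their integrals come from the
  quadratic form at an iterate.\<close>

lemma moments:
  assumes D: "\<And>k. (J ^^ k) x \<in> D"
  shows "integrable (\<mu> x) (\<lambda>l. l ^ k)"
    and "of_real (\<integral>l. l ^ k \<partial>\<mu> x) = l2_inner ((J ^^ k) x) x"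
proof -
  have x: "x \<in> D" using D[of 0] by simp
  interpret finite_measure "\<mu> x" using x D_l2 by simp
  have mu: "\<mu> ((J ^^ k) x) = density (\<mu> x) (\<lambda>l. ennreal (l ^ (2 * k)))" for k
  proof (induction k)
    case (Suc k)
    have "\<mu> ((J ^^ Suc k) x) = density (\<mu> ((J ^^ k) x)) (\<lambda>l. ennreal (l\<^sup>2))"
      using mu_J[of "(J ^^ k) x"] D[of k] D[of "Suc k"] by simp
    also have "\<dots> = density (\<mu> x) (\<lambda>l. ennreal (l ^ (2 * k)) * ennreal (l\<^sup>2))"
      unfolding Suc by (intro density_density_eq) auto
    also have "\<dots> = density (\<mu> x) (\<lambda>l. ennreal (l ^ (2 * Suc k)))"
      by (simp add: ennreal_mult''[symmetric] power_add[symmetric] del: power_Suc)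
    finally show ?case .
  qed (simp add: density_1)
  have even: "integrable (\<mu> x) (\<lambda>l. l ^ (2 * k)) \<and> (\<integral>l. l ^ (2 * k) \<partial>\<mu> x) = wt ((J ^^ k) x) UNIV" for k
  proof -
    have "(\<integral>\<^sup>+ l. ennreal (l ^ (2 * k)) \<partial>\<mu> x) = emeasure (\<mu> ((J ^^ k) x)) UNIV"
      unfolding mu by (simp add: emeasure_density)
    also have "\<dots> = ennreal (wt ((J ^^ k) x) UNIV)"
      using D by (simp add: emeasure_mu D_l2)
    finally have nn: "(\<integral>\<^sup>+ l. ennreal (l ^ (2 * k)) \<partial>\<mu> x) = ennreal (wt ((J ^^ k) x) UNIV)" .
    moreover have "integrable (\<mu> x) (\<lambda>l. l ^ (2 * k))"
      using nn by (intro integrableI_nonneg) auto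
    ultimately show ?thesis
      using D wt_nonneg by (simp add: integral_eq_nn_integral D_l2)
  qed
  show int: "integrable (\<mu> x) (\<lambda>l. l ^ k)" for k
  proof (rule Bochner_Integration.integrable_bound)
    show "integrable (\<mu> x) (\<lambda>l. 1 + l ^ (2 * k))" using even[of k] by simp
    have "\<bar>l ^ k\<bar> \<le> 1 + l ^ (2 * k)" for l :: real
    proof -
      have "0 \<le> (\<bar>l ^ k\<bar> - 1)\<^sup>2" by simp
      then have "2 * \<bar>l ^ k\<bar> \<le> 1 + (l ^ k)\<^sup>2" by (simp add: power2_diff)
      then show ?thesis by (simp add: power_even_eq)
    qed
    then show "AE l in \<mu> x. norm (l ^ k) \<le> norm (1 + l ^ (2 * k))"
      by (intro AE_I2) (simp add: power_abs)
  qed simp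
  have shift: "l2_inner ((J ^^ i) x) ((J ^^ j) x) = l2_inner ((J ^^ (i + j)) x) x" for i j
  proof (induction j arbitrary: i)
    case (Suc j)
    have "l2_inner ((J ^^ i) x) ((J ^^ Suc j) x) = l2_inner ((J ^^ Suc i) x) ((J ^^ j) x)"
      using J_symmetric[OF D[of i] D[of j]] by simp
    then show ?case using Suc[of "Suc i"] by simp
  qed simp
  show "of_real (\<integral>l. l ^ k \<partial>\<mu> x) = l2_inner ((J ^^ k) x) x"
  proof (cases "even k")
    case True
    then obtain j where k: "k = 2 * j" by (elim evenE)
    have "of_real (\<integral>l. l ^ k \<partial>\<mu> x) = l2_inner ((J ^^ j) x) ((J ^^ j) x)"
      using even[of j] wt_eq_inner(1)[of UNIV "(J ^^ j) x"] D by (simp add: k E_UNIV D_l2)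
    then show ?thesis by (simp add: shift k mult_2)
  next
    case False
    then obtain j where k: "k = 2 * j + 1" by (elim oddE)
    have "(\<integral>l. l ^ k \<partial>\<mu> x) = (\<integral>l. l \<partial>\<mu> ((J ^^ j) x))"
      unfolding mu by (subst integral_density) (auto simp: k power_commutes)
    then have "of_real (\<integral>l. l ^ k \<partial>\<mu> x) = l2_inner ((J ^^ Suc j) x) ((J ^^ j) x)"
      using quadratic_form[OF D[of j]] by simp
    also have "\<dots> = l2_inner ((J ^^ k) x) x"
      unfolding shift k by (simp add: mult_2)
    finally show ?thesis .
  qed
qed

end

section \<open>The Jacobi operator\<close>

definition finseq :: "cseq set" where
  "finseq = {x. x 0 = 0 \<and> finite {n. x n \<noteq> 0}}"

lemma finseq_bounded:
  assumes "x \<in> finseq"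
  obtains N where "\<And>n. n > N \<Longrightarrow> x n = 0"
proof -
  have "finite {n. x n \<noteq> 0}" using assms by (simp add: finseq_def)
  then obtain N where "\<forall>n\<in>{n. x n \<noteq> 0}. n \<le> N" using finite_nat_set_iff_bounded_le by auto
  then show ?thesis by (intro that[of N]) force
qed

lemma finseqI:
  assumes "x 0 = 0" "\<And>n. n > N \<Longrightarrow> x n = 0"
  shows "x \<in> finseq"
proof -
  have "{n. x n \<noteq> 0} \<subseteq> {..N}" using assms by (auto simp: not_less[symmetric])
  then show ?thesis using assms(1) finite_subset by (auto simp: finseq_def)
qed

lemma finseq_l2: "x \<in> finseq \<Longrightarrow> x \<in> l2"
  by (auto simp: finseq_def l2_def intro!: summable_finite[of "{n. x n \<noteq> 0}"])

lemma jacobi_matrix_sym: "jacobi_matrix a b i j = jacobi_matrix a b j i"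
  by (simp add: jacobi_matrix_def)

lemma jacobi_matrix_band: "Suc i < j \<or> Suc j < i \<Longrightarrow> jacobi_matrix a b i j = 0"
  by (auto simp: jacobi_matrix_def)

lemma jacobi_apply_0 [simp]: "jacobi_apply a b x 0 = 0"
  by (simp add: jacobi_apply_def)

text \<open>Row n vanishes beyond column n + 1, so any range covering that column or the support of
  x will do. This gives common finite ranges for exchanging sums.\<close>

lemma jacobi_apply_eq_sum:
  assumes "n \<ge> 1" "Suc n \<le> N \<or> (\<forall>j>N. x j = 0)"
  shows "jacobi_apply a b x n = (\<Sum>j = 1..N. of_real (jacobi_matrix a b n j) * x j)"
proof -
  have "(\<Sum>j = 1..Suc n. of_real (jacobi_matrix a b n j) * x j)
      = (\<Sum>j = 1..max (Suc n) N. of_real (jacobi_matrix a b n j) * x j)"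
    by (rule sum.mono_neutral_left) (auto simp: jacobi_matrix_band)
  also have "\<dots> = (\<Sum>j = 1..N. of_real (jacobi_matrix a b n j) * x j)"
    using assms(2) by (intro sum.mono_neutral_right) auto
  finally show ?thesis using assms(1) by (simp add: jacobi_apply_def)
qed

lemma jacobi_apply_add: "jacobi_apply a b (x + y) = jacobi_apply a b x + jacobi_apply a b y"
  by (auto simp: jacobi_apply_def fun_eq_iff algebra_simps sum.distrib)

lemma jacobi_apply_scale: "jacobi_apply a b (cscale c x) = cscale c (jacobi_apply a b x)"
  by (auto simp: jacobi_apply_def cscale_def fun_eq_iff sum_distrib_left algebra_simps)

lemma jacobi_apply_finseq:
  assumes "x \<in> finseq"
  shows "jacobi_apply a b x \<in> finseq"
proof -
  obtain N where N: "\<And>n. n > N \<Longrightarrow> x n = 0" using assms finseq_bounded by blast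
  show ?thesis
  proof (rule finseqI)
    fix n assume "n > Suc N"
    then show "jacobi_apply a b x n = 0"
      using jacobi_apply_eq_sum[of n N x a b] N by (simp add: jacobi_matrix_band)
  qed simp
qed

lemma l2_inner_finite:
  assumes "x 0 = 0 \<or> y 0 = 0" "\<And>n. n > N \<Longrightarrow> x n = 0 \<or> y n = 0"
  shows "l2_inner x y = (\<Sum>n = 1..N. x n * cnj (y n))"
  unfolding l2_inner_def
proof (rule suminf_finite)
  fix n assume "n \<notin> {1..N}"
  then show "x n * cnj (y n) = 0" using assms assms(2)[of n] by (cases n) auto
qed simp

text \<open>With one finitely supported factor all sums are finite, so no boundary term at infinity
  arises.\<close>

lemma jacobi_apply_symmetric:
  assumes "w \<in> finseq" "x 0 = 0"
  shows "l2_inner (jacobi_apply a b w) x = l2_inner w (jacobi_apply a b x)"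
proof -
  obtain N where N: "\<And>n. n > N \<Longrightarrow> w n = 0" using assms finseq_bounded by blast
  have N': "jacobi_apply a b w n = 0" if "n > Suc N" for n
    using jacobi_apply_eq_sum[of n N w a b] N that by (simp add: jacobi_matrix_band)
  have "l2_inner (jacobi_apply a b w) x = (\<Sum>n = 1..Suc N. jacobi_apply a b w n * cnj (x n))"
    using N' assms by (intro l2_inner_finite) auto
  also have "\<dots> = (\<Sum>n = 1..Suc N. \<Sum>j = 1..N. of_real (jacobi_matrix a b n j) * w j * cnj (x n))"
    using N by (intro sum.cong refl) (simp add: jacobi_apply_eq_sum[of _ N] sum_distrib_right)
  also have "\<dots> = (\<Sum>j = 1..N. \<Sum>n = 1..Suc N. of_real (jacobi_matrix a b n j) * w j * cnj (x n))"
    by (rule sum.swap)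
  also have "\<dots> = (\<Sum>j = 1..N. w j * cnj (jacobi_apply a b x j))"
  proof (intro sum.cong refl)
    fix j assume "j \<in> {1..N}"
    then have "jacobi_apply a b x j = (\<Sum>n = 1..Suc N. of_real (jacobi_matrix a b j n) * x n)"
      by (intro jacobi_apply_eq_sum) auto
    then have "w j * cnj (jacobi_apply a b x j) = (\<Sum>n = 1..Suc N. w j * (of_real (jacobi_matrix a b j n) * cnj (x n)))"
      by (simp only: cnj_sum complex_cnj_mult complex_cnj_complex_of_real sum_distrib_left)
    then show "(\<Sum>n = 1..Suc N. of_real (jacobi_matrix a b n j) * w j * cnj (x n)) = w j * cnj (jacobi_apply a b x j)"
      by (simp only: jacobi_matrix_sym[of a b _ j] mult.assoc mult.left_commute[of "w j"])
  qed
  also have "\<dots> = l2_inner w (jacobi_apply a b x)"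
    using N assms by (intro l2_inner_finite[symmetric]) auto
  finally show ?thesis .
qed

section \<open>Adjoint, closure and self-adjoint realization\<close>

lemma jacobi_op_iff: "(x, y) \<in> jacobi_op a b \<longleftrightarrow> x \<in> finseq \<and> y = jacobi_apply a b x"
  by (auto simp: jacobi_op_def finseq_def)

definition unit_seq :: "nat \<Rightarrow> cseq" where
  "unit_seq k = (\<lambda>n. if n = k then 1 else 0)"

lemma unit_seq_finseq: "k \<ge> 1 \<Longrightarrow> unit_seq k \<in> finseq"
  by (rule finseqI[of _ k]) (auto simp: unit_seq_def)

lemma l2_inner_unit_seq: "l2_inner (unit_seq k) x = cnj (x k)"
  unfolding l2_inner_def by (subst suminf_finite[of "{k}"]) (auto simp: unit_seq_def)

text \<open>Testing the adjoint relation against the unit vectors identifies y component by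
  component.\<close>

lemma op_adjoint_jacobi:
  assumes "(x, y) \<in> op_adjoint (jacobi_op a b)"
  shows "x \<in> l2 \<and> y \<in> l2 \<and> y = jacobi_apply a b x"
proof -
  have l2: "x \<in> l2" "y \<in> l2" and adj: "\<And>w. w \<in> finseq \<Longrightarrow> l2_inner (jacobi_apply a b w) x = l2_inner w y"
    using assms by (auto simp: op_adjoint_def jacobi_op_iff)
  have "y k = jacobi_apply a b x k" for k
  proof (cases "k \<ge> 1")
    case True
    then show ?thesis
      using adj[OF unit_seq_finseq[OF True]] jacobi_apply_symmetric[OF unit_seq_finseq[OF True], of x a b] l2
      by (simp add: l2_inner_unit_seq l2_def)
  next
    case False
    then have "k = 0" by simp
    then show ?thesis using l2 by (simp add: l2_def)
  qed
  then show ?thesis using l2 by auto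
qed

lemma l2_norm_tendsto_component:
  assumes "\<And>n. X n \<in> l2" "x \<in> l2" "(\<lambda>n. l2_norm (X n - x)) \<longlonglongrightarrow> 0"
  shows "(\<lambda>n. X n k) \<longlonglongrightarrow> x k"
proof -
  have "cmod (X n k - x k) \<le> l2_norm (X n - x)" for n
    using cmod_le_l2_norm[OF l2_diff[OF assms(1,2)], of n k] by simp
  then have "(\<lambda>n. X n k - x k) \<longlonglongrightarrow> 0"
    by (intro Lim_null_comparison[OF _ assms(3)]) auto
  then show ?thesis by (simp add: LIM_zero_iff)
qed

text \<open>Norm convergence implies componentwise convergence, and each component of the image is a
  finite sum of components of the argument.\<close>

lemma op_closure_jacobi:
  assumes "(x, y) \<in> op_closure (jacobi_op a b)"
  shows "x \<in> l2 \<and> y \<in> l2 \<and> y = jacobi_apply a b x"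
proof -
  obtain X Y where l2: "x \<in> l2" "y \<in> l2" and XY: "\<And>n. (X n, Y n) \<in> jacobi_op a b"
    and lim: "(\<lambda>n. l2_norm (X n - x)) \<longlonglongrightarrow> 0" "(\<lambda>n. l2_norm (Y n - y)) \<longlonglongrightarrow> 0"
    using assms by (auto simp: op_closure_def)
  have fin: "X n \<in> finseq" and Y: "Y n = jacobi_apply a b (X n)" for n
    using XY[of n] by (auto simp: jacobi_op_iff)
  have X': "(\<lambda>n. X n k) \<longlonglongrightarrow> x k" and Y': "(\<lambda>n. Y n k) \<longlonglongrightarrow> y k" for k
    using l2 fin lim Y by (auto intro!: l2_norm_tendsto_component finseq_l2 jacobi_apply_finseq)
  have "y k = jacobi_apply a b x k" for k
  proof (rule LIMSEQ_unique[OF Y'])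
    show "(\<lambda>n. Y n k) \<longlonglongrightarrow> jacobi_apply a b x k"
      unfolding Y jacobi_apply_def by (auto intro!: tendsto_intros X')
  qed
  then show ?thesis using l2 by auto
qed

lemma jacobi_op_subset_closure:
  assumes "x \<in> finseq"
  shows "(x, jacobi_apply a b x) \<in> op_closure (jacobi_op a b)"
proof -
  have "l2_norm (z - z) = 0" for z by (simp add: l2_norm_def)
  then have "\<exists>X Y. (\<forall>n::nat. (X n, Y n) \<in> jacobi_op a b) \<and>
      (\<lambda>n. l2_norm (X n - x)) \<longlonglongrightarrow> 0 \<and> (\<lambda>n. l2_norm (Y n - jacobi_apply a b x)) \<longlonglongrightarrow> 0"
    using assms
    by (intro exI[of _ "\<lambda>_. x"] exI[of _ "\<lambda>_. jacobi_apply a b x"]) (simp add: jacobi_op_iff)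
  then show ?thesis
    using assms by (simp add: op_closure_def finseq_l2 jacobi_apply_finseq)
qed

text \<open>Both the closure and the restriction of the adjoint act by the three-term expression.
  Together with the next lemma this is all the later argument uses about the realization.\<close>

lemma jacobi_realization_apply:
  assumes "(x, y) \<in> jacobi_realization a b \<alpha>"
  shows "x \<in> l2 \<and> y \<in> l2 \<and> y = jacobi_apply a b x"
  using assms op_adjoint_jacobi op_closure_jacobi
  by (auto simp: jacobi_realization_def split: if_splits)

lemma jacobi_op_subset_realization:
  assumes x: "x \<in> finseq"
  shows "(x, jacobi_apply a b x) \<in> jacobi_realization a b \<alpha>"
proof -
  have "(x, jacobi_apply a b x) \<in> op_adjoint (jacobi_op a b)"
    using finseq_l2[OF x] finseq_l2[OF jacobi_apply_finseq[OF x, of a b]] jacobi_apply_symmetric[of _ x a b]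
    by (auto simp: op_adjoint_def jacobi_op_iff l2_def)
  moreover have "\<exists>u\<in>Domain (op_closure (jacobi_op a b)). \<exists>v\<in>cseq.span {ext_vector a b \<alpha>}. x = u + v"
    using jacobi_op_subset_closure[OF x] by (intro bexI[of _ x] bexI[of _ 0] DomainI) (auto intro: cseq.span_zero)
  ultimately show ?thesis
    using jacobi_op_subset_closure[OF x]
    by (auto simp: jacobi_realization_def)
qed

text \<open>\<open>jacobi_power\<close> multiplies on the right while \<open>jacobi_apply\<close>
  reads rows; symmetry of the matrix reconciles the two.\<close>

lemma jacobi_apply_iterate:
  "n \<ge> 1 \<Longrightarrow> (jacobi_apply a b ^^ k) e1 n = of_real (jacobi_power a b k 1 n)"
proof (induction k arbitrary: n)
  case 0
  then show ?case by (simp add: e1_def)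
next
  case (Suc k)
  then show ?case
    by (simp add: jacobi_apply_def jacobi_matrix_sym[of a b n] mult.commute)
qed

lemma e1_finseq: "e1 \<in> finseq"
  using unit_seq_finseq[of 1] by (simp add: unit_seq_def e1_def)

lemma spectral_measure_moments:
  assumes E: "spectral_pvm E (jacobi_realization a b \<alpha>)"
  shows "finite_measure (pvm_measure E e1)" "sets (pvm_measure E e1) = sets borel"
    and "integrable (pvm_measure E e1) (\<lambda>l. l ^ k)"
    and "(\<integral>l. l ^ k \<partial>pvm_measure E e1) = jacobi_moment a b k"
proof -
  interpret pvm E using E by unfold_locales (simp add: spectral_pvm_def)
  let ?J = "jacobi_apply a b"
  let ?T = "jacobi_realization a b \<alpha>"
  have dom: "Domain ?T = D" and quad: "\<And>x y. (x, y) \<in> ?T \<Longrightarrow> l2_inner y x = of_real (\<integral>l. l \<partial>\<mu> x)"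
    using E by (auto simp: spectral_pvm_def D_def)
  \<comment> \<open>Every graph pair has second component \<open>?J x\<close>, so the quadratic form
    supplied by E becomes a statement about \<open>?J\<close> on all of \<open>D\<close>.\<close>
  have T: "(x, ?J x) \<in> ?T" if x: "x \<in> D" for x
  proof -
    obtain y where "(x, y) \<in> ?T" using x unfolding dom[symmetric] by (elim DomainE)
    then show ?thesis using jacobi_realization_apply[of x y a b \<alpha>] by simp
  qed
  have "?J x \<in> l2" if "x \<in> D" for x
    using jacobi_realization_apply[OF T[OF that]] by simp
  then interpret spectral_operator E ?J
    using quad[OF T] by unfold_locales (simp_all add: jacobi_apply_add jacobi_apply_scale)
  have it: "(?J ^^ k) e1 \<in> finseq" for k
    by (induction k) (simp_all add: e1_finseq jacobi_apply_finseq)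
  then have D: "(?J ^^ k) e1 \<in> D" for k
    using jacobi_op_subset_realization[OF it, of k a b \<alpha>] unfolding dom[symmetric] by blast
  show "finite_measure (\<mu> e1)" using D[of 0] D_l2 by simp
  show "sets (\<mu> e1) = sets borel" by simp
  show "integrable (\<mu> e1) (\<lambda>l. l ^ k)" by (rule moments(1)[OF D])
  have "l2_inner ((?J ^^ k) e1) e1 = (?J ^^ k) e1 1"
    by (subst l2_inner_finite[of _ _ 1]) (auto simp: e1_def)
  then have "complex_of_real (\<integral>l. l ^ k \<partial>\<mu> e1) = of_real (jacobi_moment a b k)"
    using moments(2)[OF D, of k] by (simp add: jacobi_apply_iterate jacobi_moment_def)
  then show "(\<integral>l. l ^ k \<partial>\<mu> e1) = jacobi_moment a b k" by (simp only: of_real_eq_iff)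
qed

section \<open>Exponentially weighted moments\<close>

text \<open>Only points of S are compared with t, so the criterion also yields the one-sided
  derivative at the endpoint 0.\<close>

lemma has_real_derivative_quadratic_bound:
  fixes f :: "real \<Rightarrow> real"
  assumes "\<And>s. s \<in> S \<Longrightarrow> \<bar>s - t\<bar> \<le> 1 \<Longrightarrow> \<bar>f s - f t - D * (s - t)\<bar> \<le> C * (s - t)\<^sup>2"
  shows "(f has_real_derivative D) (at t within S)"
proof -
  have "\<forall>\<^sub>F s in at t within S. norm ((f s - f t) / (s - t) - D) \<le> C * \<bar>s - t\<bar>"
    unfolding eventually_at
  proof (intro exI[of _ 1] conjI ballI impI)
    fix s assume s: "s \<in> S" "s \<noteq> t \<and> dist s t < 1"
    have "(f s - f t) / (s - t) - D = (f s - f t - D * (s - t)) / (s - t)"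
      using s by (simp add: field_simps)
    then have "norm ((f s - f t) / (s - t) - D) = \<bar>f s - f t - D * (s - t)\<bar> / \<bar>s - t\<bar>"
      by simp
    also have "\<dots> \<le> C * (s - t)\<^sup>2 / \<bar>s - t\<bar>"
      using s by (intro divide_right_mono assms) (auto simp: dist_real_def)
    also have "\<dots> = C * \<bar>s - t\<bar>"
    proof -
      have "C * (s - t)\<^sup>2 = C * \<bar>s - t\<bar> * \<bar>s - t\<bar>" by (simp add: power2_eq_square)
      then show ?thesis using s by (metis abs_eq_0 eq_iff_diff_eq_0 nonzero_mult_div_cancel_right)
    qed
    finally show "norm ((f s - f t) / (s - t) - D) \<le> C * \<bar>s - t\<bar>" .
  qed simp
  moreover have "((\<lambda>s. C * \<bar>s - t\<bar>) \<longlongrightarrow> 0) (at t within S)"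
    by (auto intro!: tendsto_eq_intros)
  ultimately have "((\<lambda>s. (f s - f t) / (s - t) - D) \<longlongrightarrow> 0) (at t within S)"
    by (rule Lim_null_comparison)
  then show ?thesis
    unfolding has_field_derivative_iff by (rule LIM_zero_cancel)
qed

text \<open>Convexity of exp, used in both directions between x and y, bounds the remainder by (y -
  x)(exp y - exp x). The order of x and y is irrelevant, which permits s on either side of
  t.\<close>

lemma exp_taylor1_bound:
  fixes x y :: real
  assumes "exp x \<le> c" "exp y \<le> c"
  shows "\<bar>exp y - exp x - (y - x) * exp x\<bar> \<le> c * (y - x)\<^sup>2"
proof -
  have le: "exp u - exp v \<ge> (u - v) * exp v" for u v :: real
  proof -
    have "(1 + (u - v)) * exp v \<le> exp (u - v) * exp v"
      by (intro mult_right_mono exp_ge_add_one_self) simp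
    then show ?thesis by (simp add: algebra_simps flip: exp_add)
  qed
  have "0 \<le> exp y - exp x - (y - x) * exp x" using le[of x y] by (simp add: le)
  moreover have "exp y - exp x - (y - x) * exp x \<le> (y - x) * (exp y - exp x)"
    using le[of x y] by (simp add: algebra_simps)
  moreover have "(y - x) * (exp y - exp x) \<le> (y - x) * ((y - x) * c)"
  proof (cases "y \<ge> x")
    case True
    have "exp y - exp x \<le> (y - x) * exp y" using le[of x y] by (simp add: algebra_simps)
    also have "\<dots> \<le> (y - x) * c" using True assms by (intro mult_left_mono) auto
    finally show ?thesis using True by (intro mult_left_mono) auto
  next
    case False
    have "(y - x) * c \<le> (y - x) * exp x" using False assms by (intro mult_left_mono_neg) auto
    also have "\<dots> \<le> exp y - exp x" by (rule le)
    finally show ?thesis using False by (intro mult_left_mono_neg) auto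
  qed
  ultimately show ?thesis by (simp add: power2_eq_square algebra_simps)
qed

text \<open>The complement of the support is a union of open null sets; by Lindelof countably many
  of them cover it, so it is null.\<close>

lemma AE_less_if_support:
  assumes "sets \<rho> = sets borel" "measure_support \<rho> \<subseteq> {..<M}"
  shows "AE l in \<rho>. l < M"
proof -
  define \<U> where "\<U> = {U. open U \<and> emeasure \<rho> U = 0}"
  obtain \<V> where V: "\<V> \<subseteq> \<U>" "countable \<V>" "\<Union>\<V> = \<Union>\<U>"
    using Lindelof[of \<U>] by (auto simp: \<U>_def)
  have "(\<Union>U\<in>\<V>. U) \<in> null_sets \<rho>"
    using V assms(1) by (intro null_sets_UN' ) (auto simp: \<U>_def null_sets_def)
  moreover have "{l \<in> space \<rho>. \<not> l < M} \<subseteq> (\<Union>U\<in>\<V>. U)"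
  proof
    fix l assume "l \<in> {l \<in> space \<rho>. \<not> l < M}"
    then have "l \<notin> measure_support \<rho>" using assms(2) by auto
    then have "l \<in> \<Union>\<U>" by (auto simp: measure_support_def \<U>_def not_less)
    then show "l \<in> (\<Union>U\<in>\<V>. U)" using V(3) by simp
  qed
  ultimately show ?thesis by (rule AE_I')
qed

section \<open>Differentiation and positivity of the weighted moments\<close>

locale bounded_above_moments =
  fixes \<rho> :: "real measure" and M :: real
  assumes sets_rho [measurable_cong, simp]: "sets \<rho> = sets borel"
    and powers: "\<And>k. integrable \<rho> (\<lambda>l. l ^ k)"
    and below: "AE l in \<rho>. l < M"
begin

definition F :: "nat \<Rightarrow> real \<Rightarrow> real" where
  "F k t = (\<integral>l. l ^ k * exp (2 * l * t) \<partial>\<rho>)"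

lemma exp_bound: "t \<ge> 0 \<Longrightarrow> t \<le> T \<Longrightarrow> l < M \<Longrightarrow> exp (2 * l * t) \<le> exp (2 * \<bar>M\<bar> * T)"
proof -
  assume "t \<ge> 0" "t \<le> T" "l < M"
  then have "l * t \<le> \<bar>M\<bar> * t" "\<bar>M\<bar> * t \<le> \<bar>M\<bar> * T"
    by (auto intro!: mult_right_mono mult_left_mono)
  then show ?thesis by simp
qed

lemma integrable_powers_exp:
  assumes "t \<ge> 0"
  shows "integrable \<rho> (\<lambda>l. l ^ k * exp (2 * l * t))"
proof (rule Bochner_Integration.integrable_bound)
  show "integrable \<rho> (\<lambda>l. l ^ k * exp (2 * \<bar>M\<bar> * t))" using powers by simp
  show "AE l in \<rho>. norm (l ^ k * exp (2 * l * t)) \<le> norm (l ^ k * exp (2 * \<bar>M\<bar> * t))"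
    using below
  proof eventually_elim
    case (elim l)
    then show ?case using exp_bound[OF assms order_refl elim] by (simp add: abs_mult mult_left_mono)
  qed
qed simp

lemma F_derivative:
  assumes t: "t \<ge> 0"
  shows "(F k has_real_derivative 2 * F (Suc k) t) (at t within {0..})"
proof (rule has_real_derivative_quadratic_bound)
  \<comment> \<open>K bounds both exponentials, as s is at most t + 1 and l < M almost everywhere.
    The 4 in \<open>C\<close> is the square of the factor 2 in the exponent.\<close>
  define K where "K = exp (2 * \<bar>M\<bar> * (t + 1))"
  define C where "C = 4 * K * (\<integral>l. \<bar>l ^ (k + 2)\<bar> \<partial>\<rho>)"
  fix s assume s: "s \<in> {0..}" "\<bar>s - t\<bar> \<le> 1"
  define R where "R l = l ^ k * exp (2 * l * s) - l ^ k * exp (2 * l * t)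
      - 2 * (s - t) * (l ^ Suc k * exp (2 * l * t))" for l
  have int: "integrable \<rho> (\<lambda>l. l ^ j * exp (2 * l * s))" "integrable \<rho> (\<lambda>l. l ^ j * exp (2 * l * t))" for j
    using integrable_powers_exp s t by auto
  have "F k s - F k t - 2 * F (Suc k) t * (s - t) = (\<integral>l. R l \<partial>\<rho>)"
    unfolding F_def R_def using int[of k] int[of "Suc k"]
    by (simp del: power_Suc)
  also have "\<bar>\<dots>\<bar> \<le> (\<integral>l. 4 * K * (s - t)\<^sup>2 * \<bar>l ^ (k + 2)\<bar> \<partial>\<rho>)"
  proof (rule order_trans[OF integral_abs_bound integral_mono_AE], unfold real_norm_def[symmetric])
    show "integrable \<rho> (\<lambda>l. norm (R l))" unfolding R_def
      by (intro integrable_norm Bochner_Integration.integrable_diff integrable_mult_right int)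
    show "integrable \<rho> (\<lambda>l. 4 * K * (s - t)\<^sup>2 * norm (l ^ (k + 2)))"
      by (intro integrable_mult_right integrable_norm powers)
    show "AE l in \<rho>. norm (R l) \<le> 4 * K * (s - t)\<^sup>2 * norm (l ^ (k + 2))"
      using below
    proof eventually_elim
      case (elim l)
      have "exp (2 * l * t) \<le> K" "exp (2 * l * s) \<le> K"
        unfolding K_def using s t elim by (intro exp_bound; simp)+
      then have b: "\<bar>exp (2 * l * s) - exp (2 * l * t) - (2 * l * s - 2 * l * t) * exp (2 * l * t)\<bar>
          \<le> K * (2 * l * s - 2 * l * t)\<^sup>2"
        by (rule exp_taylor1_bound)
      have "R l = l ^ k * (exp (2 * l * s) - exp (2 * l * t) - (2 * l * s - 2 * l * t) * exp (2 * l * t))"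
        by (simp add: R_def algebra_simps)
      then have "norm (R l) \<le> \<bar>l ^ k\<bar> * (K * (2 * l * s - 2 * l * t)\<^sup>2)"
        using b by (simp add: abs_mult mult_left_mono)
      also have "(2 * l * s - 2 * l * t)\<^sup>2 = 4 * (s - t)\<^sup>2 * l\<^sup>2"
        by (simp add: power2_eq_square algebra_simps)
      also have "\<bar>l ^ k\<bar> * (K * (4 * (s - t)\<^sup>2 * l\<^sup>2)) = 4 * K * (s - t)\<^sup>2 * norm (l ^ (k + 2))"
        unfolding power_add by (simp add: abs_mult)
      finally show ?case .
    qed
  qed
  also have "\<dots> = C * (s - t)\<^sup>2"
    by (simp add: C_def)
  finally show "\<bar>F k s - F k t - 2 * F (Suc k) t * (s - t)\<bar> \<le> C * (s - t)\<^sup>2" .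
qed

lemma mfun_F:
  assumes "t \<ge> 0"
  shows "integrable \<rho> (\<lambda>l. poly q l * exp (2 * l * t))"
    and "mfun (\<lambda>i. F i t) q = (\<integral>l. poly q l * exp (2 * l * t) \<partial>\<rho>)"
proof -
  have e: "poly q l * exp (2 * l * t) = (\<Sum>i\<le>degree q. coeff q i * (l ^ i * exp (2 * l * t)))" for l
    by (simp add: poly_altdef sum_distrib_right mult.assoc)
  show "integrable \<rho> (\<lambda>l. poly q l * exp (2 * l * t))"
    unfolding e using integrable_powers_exp[OF assms]
    by (intro Bochner_Integration.integrable_sum integrable_mult_right)
  have "(\<integral>l. poly q l * exp (2 * l * t) \<partial>\<rho>) = (\<Sum>i\<le>degree q. \<integral>l. coeff q i * (l ^ i * exp (2 * l * t)) \<partial>\<rho>)"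
    unfolding e using integrable_powers_exp[OF assms]
    by (intro Bochner_Integration.integral_sum integrable_mult_right)
  then show "mfun (\<lambda>i. F i t) q = (\<integral>l. poly q l * exp (2 * l * t) \<partial>\<rho>)"
    by (simp add: mfun_def F_def)
qed

text \<open>If \<open>p\<^sup>2\<close> had integral zero, \<open>p\<close> would vanish almost everywhere and hence be orthogonal to the
  orthogonal polynomial of the same degree at \<open>t = 0\<close>.\<close>
lemma F_positive:
  assumes jac: "\<And>n. n \<ge> 1 \<Longrightarrow> a n > 0" "\<And>k. (\<integral>l. l ^ k \<partial>\<rho>) = jacobi_moment a b k"
    and t: "t \<ge> 0"
  shows "positive_moments (\<lambda>i. F i t)"
proof
  fix p :: "real poly" assume p: "p \<noteq> 0"
  let ?q = "opoly a b (degree p)"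
  have nonneg: "mfun (\<lambda>i. F i t) (p * p) \<ge> 0"
    by (simp add: mfun_F[OF t] integral_nonneg_AE)
  show "mfun (\<lambda>i. F i t) (p * p) > 0"
  proof (rule ccontr)
    assume "\<not> ?thesis"
    then have "(\<integral>l. poly (p * p) l * exp (2 * l * t) \<partial>\<rho>) = 0"
      using nonneg mfun_F(2)[OF t, of "p * p"] by linarith
    then have "AE l in \<rho>. poly (p * p) l * exp (2 * l * t) = 0"
      using mfun_F(1)[OF t, of "p * p"] by (subst (asm) integral_nonneg_eq_0_iff_AE) auto
    \<comment> \<open>The exponential never vanishes, so p vanishes almost everywhere and the weight
      may be replaced by the one at time 0, where the moments are those of the matrix.\<close>
    then have "AE l in \<rho>. poly (p * ?q) l * exp (2 * l * 0) = 0"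
      by eventually_elim auto
    then have "mfun (\<lambda>i. F i 0) (p * ?q) = 0"
      by (simp only: mfun_F(2)[OF order_refl] integral_eq_zero_AE)
    moreover have "(\<lambda>i. F i 0) = jacobi_moment a b"
      by (simp add: fun_eq_iff F_def jac(2))
    ultimately have "coeff p (degree p) * (\<Prod>i = 1..degree p. a i)\<^sup>2 = 0"
      by (simp add: mfun_opoly_degree_eq)
    moreover have "(\<Prod>i = 1..degree p. a i)\<^sup>2 > 0"
      using jac(1) by (intro zero_less_power prod_pos) auto
    ultimately show False using p by (metis leading_coeff_0_iff less_irrefl mult_eq_0_iff)
  qed
qed

end

section \<open>The Toda lattice\<close>

theorem theorem2:
  fixes a0 b0 :: "nat \<Rightarrow> real"
    and \<alpha> :: ext_param
    and E :: "real set \<Rightarrow> cseq \<Rightarrow> cseq"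
    and \<rho> :: "real measure"
    and M :: real
    and \<Omega> :: "real \<Rightarrow> real"
    and s :: "nat \<Rightarrow> real \<Rightarrow> real"
  assumes a0_pos: "\<And>n. n \<ge> 1 \<Longrightarrow> a0 n > 0"
    and alpha: "deficiency_indices (jacobi_op a0 b0) 1 1 \<Longrightarrow> is_alpha_limit a0 b0 \<alpha>"
    and E: "spectral_pvm E (jacobi_realization a0 b0 \<alpha>)"
    and rho: "\<rho> = pvm_measure E e1"
    and supp: "measure_support \<rho> \<subseteq> {..<M}"
    and Omega: "\<And>t. t \<ge> 0 \<Longrightarrow> \<Omega> t = (\<integral>l. exp (2 * l * t) \<partial>\<rho>)"
    and s: "\<And>k t. t \<ge> 0 \<Longrightarrow>
              s k t = (\<integral>l. l ^ k * exp (2 * l * t) \<partial>\<rho>) / (\<integral>l. exp (2 * l * t) \<partial>\<rho>)"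
  shows "(\<forall>t\<ge>0. \<Omega> t > 0 \<and> (\<forall>k. integrable \<rho> (\<lambda>l. l ^ k * exp (2 * l * t)))) \<and>
    (\<forall>t\<ge>0. s 0 t = 1) \<and>
    (\<forall>k. \<forall>t>0. s k differentiable at t \<and> (\<lambda>u. ln (\<Omega> u)) differentiable at t \<and>
       deriv (s k) t + deriv (\<lambda>u. ln (\<Omega> u)) t * s k t = 2 * s (Suc k) t) \<and>
    (\<exists>a b :: nat \<Rightarrow> real \<Rightarrow> real.
       (\<forall>t\<ge>0. (\<forall>n\<ge>1. a n t > 0) \<and>
          (\<forall>k. jacobi_moment (\<lambda>n. a n t) (\<lambda>n. b n t) k = s k t) \<and>
          (\<forall>a' b'. (\<forall>n\<ge>1. a' n > 0) \<longrightarrow> (\<forall>k. jacobi_moment a' b' k = s k t) \<longrightarrow>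
             (\<forall>n\<ge>1. a' n = a n t \<and> b' n = b n t))) \<and>
       (\<forall>t\<ge>0. a 0 t = 0) \<and>
       (\<forall>n\<ge>1. \<forall>t\<ge>0.
          (a n has_real_derivative a n t * (b (Suc n) t - b n t)) (at t within {0..}) \<and>
          (b n has_real_derivative 2 * ((a n t)\<^sup>2 - (a (n - 1) t)\<^sup>2)) (at t within {0..})) \<and>
       (\<forall>n\<ge>1. a n 0 = a0 n \<and> b n 0 = b0 n))"
proof -
  note mom = spectral_measure_moments[OF E, folded rho]
  interpret bounded_above_moments \<rho> M
    using mom AE_less_if_support[OF _ supp] by unfold_locales auto
  have pos: "positive_moments (\<lambda>i. F i t)" if "t \<ge> 0" for t
    using F_positive[OF a0_pos mom(4) that] .
  interpret moment_flow F "{0..}"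
    using F_derivative pos by (intro moment_flow.intro) auto
  have \<Omega>: "\<Omega> t = F 0 t" if "t \<ge> 0" for t
    using Omega[OF that] by (simp add: F_def)
  have sF: "s k t = F k t / F 0 t" if "t \<ge> 0" for k t
    using s[OF that] by (simp add: F_def)
  have F0: "F 0 t > 0" if "t \<ge> 0" for t
    using positive_moments.m0_pos[OF pos[OF that]] .
  \<comment> \<open>At interior points the derivative along the half-line is two-sided, as
    \<open>deriv\<close> requires.\<close>
  have F': "(F k has_real_derivative 2 * F (Suc k) t) (at t)" if "t > 0" for k t
  proof -
    have "(F k has_real_derivative 2 * F (Suc k) t) (at t within {0<..})"
      using that by (intro DERIV_subset[OF F_derivative]) auto
    then show ?thesis using at_within_open[of t "{0<..}"] that by simp
  qed
  have recur: "s k differentiable at t \<and> (\<lambda>u. ln (\<Omega> u)) differentiable at t \<and>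
       deriv (s k) t + deriv (\<lambda>u. ln (\<Omega> u)) t * s k t = 2 * s (Suc k) t" if t: "t > 0" for k t
  proof -
    have nz: "F 0 t > 0" using F0 t by simp
    have "((\<lambda>t. F k t / F 0 t) has_real_derivative
        (2 * F (Suc k) t * F 0 t - F k t * (2 * F (Suc 0) t)) / (F 0 t * F 0 t)) (at t)"
      using nz by (intro DERIV_divide F' t) simp
    \<comment> \<open>\<open>s\<close> is prescribed only for nonnegative times, so the derivative
      is transferred on the open half-line; the same is done for Omega below.\<close>
    then have ds: "(s k has_real_derivative
        (2 * F (Suc k) t * F 0 t - F k t * (2 * F (Suc 0) t)) / (F 0 t * F 0 t)) (at t)"
      by (rule has_field_derivative_transform_within_open[of _ _ _ "{0<..}"]) (use t sF in auto)
    have "((\<lambda>u. ln (F 0 u)) has_real_derivative 1 / F 0 t * (2 * F (Suc 0) t)) (at t)"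
      by (rule DERIV_chain2[OF DERIV_ln_divide[OF nz] F'[OF t]])
    then have dl: "((\<lambda>u. ln (\<Omega> u)) has_real_derivative 1 / F 0 t * (2 * F (Suc 0) t)) (at t)"
      by (rule has_field_derivative_transform_within_open[of _ _ _ "{0<..}"]) (use t \<Omega> in auto)
    have "deriv (s k) t + deriv (\<lambda>u. ln (\<Omega> u)) t * s k t = 2 * s (Suc k) t"
      unfolding DERIV_imp_deriv[OF ds] DERIV_imp_deriv[OF dl] using nz t
      by (simp add: sF field_simps)
    then show ?thesis using ds dl by (auto simp: real_differentiable_def)
  qed
  \<comment> \<open>The coefficients are read off the unnormalised moments, for which the flow law
    is linear; the moments of the resulting matrix are nevertheless the normalised ones.\<close>
  define a where "a n t = rec_a (\<lambda>i. F i t) n" for n t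
  define b where "b n t = rec_b (\<lambda>i. F i t) n" for n t
  have pos_a: "a n t > 0" if "t \<ge> 0" "n \<ge> 1" for n t
    using positive_moments.rec_a_pos[OF pos] that by (simp add: a_def)
  have jac: "jacobi_moment (\<lambda>n. a n t) (\<lambda>n. b n t) k = s k t" if "t \<ge> 0" for k t
    using positive_moments.jacobi_moment_rec[OF pos] that by (simp add: a_def b_def sF)
  have uniq: "a' n = a n t \<and> b' n = b n t"
    if "t \<ge> 0" "\<forall>n\<ge>1. a' n > 0" "\<forall>k. jacobi_moment a' b' k = s k t" "n \<ge> 1" for a' b' t n
    using positive_moments.jacobi_unique[OF pos, of t a' b' n] that by (simp add: a_def b_def sF)
  have a_zero: "a 0 t = 0" for t
    by (simp add: a_def rec_a_def rec_a2_def)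
  have toda: "(a n has_real_derivative a n t * (b (Suc n) t - b n t)) (at t within {0..}) \<and>
          (b n has_real_derivative 2 * ((a n t)\<^sup>2 - (a (n - 1) t)\<^sup>2)) (at t within {0..})"
    if "n \<ge> 1" "t \<ge> 0" for n t
    using toda_a[of t n] toda_b[of t n] that unfolding a_def b_def by simp
  \<comment> \<open>At t = 0 the weight is 1, so the moments are those of the initial matrix, and
    recovering coefficients from moments returns the initial data.\<close>
  have "(\<lambda>i. F i 0) = jacobi_moment a0 b0"
    using mom(4) by (simp add: fun_eq_iff F_def)
  then have init: "a n 0 = a0 n \<and> b n 0 = b0 n" if "n \<ge> 1" for n
    using jacobi_moment_determines[where a = a0 and b = b0 and n = n] a0_pos that
    by (simp add: a_def b_def)
  have 1: "\<forall>t\<ge>0. \<Omega> t > 0 \<and> (\<forall>k. integrable \<rho> (\<lambda>l. l ^ k * exp (2 * l * t)))"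
    using F0 \<Omega> integrable_powers_exp by simp
  have 2: "\<forall>t\<ge>0. s 0 t = 1"
    using F0 sF by (auto simp: less_imp_neq[symmetric])
  have 3: "\<exists>a b :: nat \<Rightarrow> real \<Rightarrow> real.
       (\<forall>t\<ge>0. (\<forall>n\<ge>1. a n t > 0) \<and>
          (\<forall>k. jacobi_moment (\<lambda>n. a n t) (\<lambda>n. b n t) k = s k t) \<and>
          (\<forall>a' b'. (\<forall>n\<ge>1. a' n > 0) \<longrightarrow> (\<forall>k. jacobi_moment a' b' k = s k t) \<longrightarrow>
             (\<forall>n\<ge>1. a' n = a n t \<and> b' n = b n t))) \<and>
       (\<forall>t\<ge>0. a 0 t = 0) \<and>
       (\<forall>n\<ge>1. \<forall>t\<ge>0.
          (a n has_real_derivative a n t * (b (Suc n) t - b n t)) (at t within {0..}) \<and>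
          (b n has_real_derivative 2 * ((a n t)\<^sup>2 - (a (n - 1) t)\<^sup>2)) (at t within {0..})) \<and>
       (\<forall>n\<ge>1. a n 0 = a0 n \<and> b n 0 = b0 n)"
    by (intro exI[of _ a] exI[of _ b] conjI allI impI)
       ((rule pos_a jac a_zero uniq[THEN conjunct1] uniq[THEN conjunct2] toda[THEN conjunct1]
           toda[THEN conjunct2] init[THEN conjunct1] init[THEN conjunct2]; assumption)+)
  show ?thesis
    by (rule conjI[OF 1 conjI[OF 2 conjI[OF _ 3]]], intro allI impI, rule recur)
qed

end
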